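(* Let $(e^{tA})_{t\ge 0}$ be a real, individually eventually positive, and persistently irreducible $C_0$-semigroup on a complex Banach lattice $E$. If $\lambda\in\mathbb R$ is an eigenvalue of both $A$ and the dual operator $A'$, and $\ker(\lambda-A')$ contains a positive non-zero functional, then $\lambda$ is algebraically simple as an eigenvalue of $A$, the eigenspace $\ker(\lambda-A)$ is spanned by a quasi-interior point of $E_+$, and $\ker(\lambda-A')$ contains a strictly positive functional.
   Context: $E_+$ is the positive cone, $E_{\mathbb R}$ the real part of $E$. A semigroup is real if $e^{tA}(E_{\mathbb R})\subseteq E_{\mathbb R}$ for all $t\ge 0$. It is individually eventually positive if for each $0\le f\in E$ there exists $t_0\ge 0$ such that $e^{tA}f\ge 0$ for all $t\ge t_0$. It is persistently irreducible if the only closed ideals $I$ of $E$ for which there exists $t_0\ge 0$ with $e^{tA}I\subseteq I$ for all $t\ge t_0$ are $\{0\}$ and $E$. A vector $u\in E_+$ is a quasi-interior point of $E_+$ if the principal ideal $E_u=\{f\in E:\ |f|\le cu\text{ for some }c>0\}$ is dense in $E$. A positive functional on $E$ is strictly positive if its kernel contains no positive non-zero element. An eigenvalue $\lambda$ of $A$ is algebraically simple if $\bigcup_{n\in\mathbb N}\ker\big((\lambda-A)^n\big)$ is one-dimensional. *)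

theory Defs
  imports "HOL-Analysis.Analysis" "HOL-Library.Lattice_Algebras"
begin

section \<open>Complex vector spaces\<close>

class complex_vector = real_vector +
  fixes scaleC :: "complex \<Rightarrow> 'a \<Rightarrow> 'a"  (infixr "*\<^sub>C" 75)
  assumes scaleC_add_right: "c *\<^sub>C (x + y) = c *\<^sub>C x + c *\<^sub>C y"
    and scaleC_add_left: "(c + d) *\<^sub>C x = c *\<^sub>C x + d *\<^sub>C x"
    and scaleC_scaleC: "c *\<^sub>C d *\<^sub>C x = (c * d) *\<^sub>C x"
    and scaleC_one: "1 *\<^sub>C x = x"
    and scaleR_scaleC: "r *\<^sub>R x = complex_of_real r *\<^sub>C x"

class complex_normed_vector = complex_vector + real_normed_vector +
  assumes norm_scaleC: "norm (c *\<^sub>C x) = norm c * norm x"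

class complex_banach = complex_normed_vector + banach

global_interpretation complex_vector: vector_space "scaleC :: complex \<Rightarrow> 'a \<Rightarrow> 'a::complex_vector"
  defines csubspace = complex_vector.subspace
    and cspan = complex_vector.span
    and cdim = complex_vector.dim
  by unfold_locales
    (simp_all add: scaleC_add_right scaleC_add_left scaleC_scaleC scaleC_one)

definition bounded_clinear :: "('a::complex_normed_vector \<Rightarrow> 'b::complex_normed_vector) \<Rightarrow> bool" where
  "bounded_clinear f \<longleftrightarrow> bounded_linear f \<and> (\<forall>c x. f (c *\<^sub>C x) = c *\<^sub>C f x)"

instantiation complex :: complex_banach
begin
definition scaleC_complex :: "complex \<Rightarrow> complex \<Rightarrow> complex" where "scaleC_complex c x = c * x"
instance
  by standard (auto simp: scaleC_complex_def algebra_simps scaleR_conv_of_real norm_mult)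
end

instantiation blinfun :: (real_normed_vector, complex_normed_vector) complex_normed_vector
begin

lift_definition scaleC_blinfun :: "complex \<Rightarrow> ('a \<Rightarrow>\<^sub>L 'b) \<Rightarrow> ('a \<Rightarrow>\<^sub>L 'b)"
  is "\<lambda>c f x. c *\<^sub>C f x"
proof -
  fix c and f :: "'a \<Rightarrow> 'b" assume f: "bounded_linear f"
  have "bounded_linear (\<lambda>y::'b. c *\<^sub>C y)"
    by (rule bounded_linear_intro[where K = "norm c"])
      (auto simp: scaleC_add_right scaleR_scaleC scaleC_scaleC norm_scaleC mult.commute)
  from bounded_linear_compose[OF this f] show "bounded_linear (\<lambda>x. c *\<^sub>C f x)" .
qed

instance
proof
  fix c d :: complex and r :: real and x y :: "'a \<Rightarrow>\<^sub>L 'b"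
  show "c *\<^sub>C (x + y) = c *\<^sub>C x + c *\<^sub>C y" by transfer (simp add: scaleC_add_right)
  show "(c + d) *\<^sub>C x = c *\<^sub>C x + d *\<^sub>C x" by transfer (simp add: scaleC_add_left)
  show "c *\<^sub>C d *\<^sub>C x = (c * d) *\<^sub>C x" by transfer (simp add: scaleC_scaleC)
  show "1 *\<^sub>C x = x" by transfer (simp add: scaleC_one)
  show "r *\<^sub>R x = complex_of_real r *\<^sub>C x" by transfer (simp add: scaleR_scaleC)
  show "norm (c *\<^sub>C x) = norm c * norm x"
  proof (rule antisym)
    have le: "norm (c *\<^sub>C x) \<le> norm c * norm x" for c and x :: "'a \<Rightarrow>\<^sub>L 'b"
    proof (rule norm_blinfun_bound)
      fix z
      have "norm (blinfun_apply (c *\<^sub>C x) z) = norm c * norm (blinfun_apply x z)"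
        by transfer (simp add: norm_scaleC)
      also have "\<dots> \<le> norm c * (norm x * norm z)"
        by (intro mult_left_mono norm_blinfun) auto
      finally show "norm (blinfun_apply (c *\<^sub>C x) z) \<le> norm c * norm x * norm z"
        by (simp add: mult.assoc)
    qed auto
    show "norm (c *\<^sub>C x) \<le> norm c * norm x" by (rule le)
    show "norm c * norm x \<le> norm (c *\<^sub>C x)"
    proof (cases "c = 0")
      case False
      have "inverse c *\<^sub>C c *\<^sub>C x = x"
        using False by transfer (simp add: scaleC_scaleC scaleC_one)
      then have "norm x \<le> inverse (norm c) * norm (c *\<^sub>C x)"
        using le[of "inverse c" "c *\<^sub>C x"] by (simp add: norm_inverse)
      then show ?thesis using False by (simp add: field_simps)
    qed auto
  qed
qed

end

text \<open>The norm dual consists of the complex-linear elements of \<open>'a \<Rightarrow>\<^sub>L complex\<close>.\<close>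

definition dual_space :: "('a::complex_normed_vector \<Rightarrow>\<^sub>L complex) set" where
  "dual_space = {\<phi>. bounded_clinear (blinfun_apply \<phi>)}"


section \<open>Unbounded operators\<close>

text \<open>An operator is represented by its graph, so that the domain of \<open>A\<close> is \<open>Domain A\<close>
  and powers, with their natural domains, are \<open>A ^^ n\<close>.\<close>

text \<open>\<open>shifted_op \<mu> A\<close> is \<open>\<mu> - A\<close>.\<close>

definition shifted_op :: "complex \<Rightarrow> ('a::complex_vector \<times> 'a) set \<Rightarrow> ('a \<times> 'a) set" where
  "shifted_op \<mu> A = {(f, \<mu> *\<^sub>C f - g) | f g. (f, g) \<in> A}"

definition op_ker :: "('a::zero \<times> 'a) set \<Rightarrow> 'a set" where
  "op_ker B = {f. (f, 0) \<in> B}"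

definition eigenvalue :: "('a::complex_vector \<times> 'a) set \<Rightarrow> complex \<Rightarrow> bool" where
  "eigenvalue A \<mu> \<longleftrightarrow> (\<exists>f. f \<noteq> 0 \<and> f \<in> op_ker (shifted_op \<mu> A))"

text \<open>The value \<open>1\<close> excludes infinite-dimensional spaces, for which \<open>cdim\<close> is \<open>0\<close>.\<close>

definition algebraically_simple :: "('a::complex_vector \<times> 'a) set \<Rightarrow> complex \<Rightarrow> bool" where
  "algebraically_simple A \<mu> \<longleftrightarrow> cdim (\<Union>n::nat. op_ker (shifted_op \<mu> A ^^ n)) = 1"

text \<open>For densely defined \<open>A\<close> this is the graph of a function.\<close>

definition dual_operator ::
    "('a::complex_normed_vector \<times> 'a) set \<Rightarrow> (('a \<Rightarrow>\<^sub>L complex) \<times> ('a \<Rightarrow>\<^sub>L complex)) set" where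
  "dual_operator A = {(\<phi>, \<psi>). \<phi> \<in> dual_space \<and> \<psi> \<in> dual_space \<and>
      (\<forall>(f, g)\<in>A. blinfun_apply \<phi> g = blinfun_apply \<psi> f)}"

definition C0_semigroup :: "(real \<Rightarrow> 'a::complex_banach \<Rightarrow> 'a) \<Rightarrow> bool" where
  "C0_semigroup T \<longleftrightarrow>
     (\<forall>t\<ge>0. bounded_clinear (T t)) \<and> T 0 = id \<and>
     (\<forall>s\<ge>0. \<forall>t\<ge>0. T (s + t) = T s \<circ> T t) \<and>
     (\<forall>f. ((\<lambda>t. T t f) \<longlongrightarrow> f) (at_right 0))"

definition generator :: "(real \<Rightarrow> 'a::complex_banach \<Rightarrow> 'a) \<Rightarrow> ('a \<times> 'a) set" where
  "generator T = {(f, g). ((\<lambda>t. (1 / t) *\<^sub>R (T t f - f)) \<longlongrightarrow> g) (at_right 0)}"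


section \<open>Real Banach lattices and their complexifications\<close>

class banach_lattice = banach + ordered_real_vector + lattice_ab_group_add_abs +
  assumes norm_mono_abs: "\<bar>x\<bar> \<le> \<bar>y\<bar> \<Longrightarrow> norm x \<le> norm y"

instance real :: banach_lattice
  by standard (auto simp: sup_real_def abs_if)

text \<open>A complex Banach lattice is the complexification of a real Banach lattice \<open>'a\<close>, with
  \<open>Complexification x y\<close> standing for \<open>x + i y\<close>.\<close>

datatype 'a complexification = Complexification (re_part: 'a) (im_part: 'a)

lemma complexification_eq_iff: "z = w \<longleftrightarrow> re_part z = re_part w \<and> im_part z = im_part w"
  by (cases z; cases w) auto

instantiation complexification :: (real_vector) complex_vector
begin

definition "0 = Complexification 0 0"
definition "z + w = Complexification (re_part z + re_part w) (im_part z + im_part w)"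
definition "z - w = Complexification (re_part z - re_part w) (im_part z - im_part w)"
definition "- z = Complexification (- re_part z) (- im_part z)"
definition "r *\<^sub>R z = Complexification (r *\<^sub>R re_part z) (r *\<^sub>R im_part z)"
definition "c *\<^sub>C z = Complexification
  (Re c *\<^sub>R re_part z - Im c *\<^sub>R im_part z) (Re c *\<^sub>R im_part z + Im c *\<^sub>R re_part z)"

lemma complexification_simps [simp]:
  "re_part 0 = (0::'a)" "im_part 0 = (0::'a)"
  "re_part (z + w) = re_part z + re_part w" "im_part (z + w) = im_part z + im_part w"
  "re_part (z - w) = re_part z - re_part w" "im_part (z - w) = im_part z - im_part w"
  "re_part (- z) = - re_part z" "im_part (- z) = - im_part z"
  "re_part (r *\<^sub>R z) = r *\<^sub>R re_part z" "im_part (r *\<^sub>R z) = r *\<^sub>R im_part z"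
  "re_part (c *\<^sub>C z) = Re c *\<^sub>R re_part z - Im c *\<^sub>R im_part z"
  "im_part (c *\<^sub>C z) = Re c *\<^sub>R im_part z + Im c *\<^sub>R re_part z"
  by (simp_all add: zero_complexification_def plus_complexification_def
      minus_complexification_def uminus_complexification_def scaleR_complexification_def
      scaleC_complexification_def)

instance
  by standard (simp_all add: complexification_eq_iff algebra_simps)

end

definition real_subspace :: "'a::real_vector complexification set" where
  "real_subspace = {z. im_part z = 0}"

text \<open>The order whose positive cone is that of the real part (cf. \<open>HOL-Library.Complex_Order\<close>):
  \<open>0 \<le> z\<close> entails that \<open>z\<close> is real.\<close>

instantiation complexification :: ("{real_vector, ordered_ab_group_add}") ordered_ab_group_add
begin

definition "z \<le> w \<longleftrightarrow> re_part z \<le> re_part w \<and> im_part z = im_part w"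
definition "z < w \<longleftrightarrow> re_part z < re_part w \<and> im_part z = im_part w"

instance
  by standard
    (auto simp: less_eq_complexification_def less_complexification_def complexification_eq_iff)

end

text \<open>The modulus \<open>\<bar>z\<bar> = sup {Re (c z) : \<bar>c\<bar> = 1}\<close>, equivalently the supremum of
  \<open>cos \<theta> x + sin \<theta> y\<close> over all \<open>\<theta>\<close> for \<open>z = x + i y\<close>; the supremum
  exists by \<open>is_modulus_modulus\<close> below.\<close>

definition is_modulus :: "'a::banach_lattice complexification \<Rightarrow> 'a \<Rightarrow> bool" where
  "is_modulus z m \<longleftrightarrow> (\<forall>c. norm c = 1 \<longrightarrow> re_part (c *\<^sub>C z) \<le> m) \<and>
     (\<forall>v. (\<forall>c. norm c = 1 \<longrightarrow> re_part (c *\<^sub>C z) \<le> v) \<longrightarrow> m \<le> v)"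

definition modulus :: "'a::banach_lattice complexification \<Rightarrow> 'a" where
  "modulus z = (THE m. is_modulus z m)"

instantiation complexification :: (banach_lattice) abs
begin
definition "\<bar>z\<bar> = Complexification (modulus z) 0"
instance ..
end

lemma norm_abs_banach_lattice: "norm \<bar>x::'a::banach_lattice\<bar> = norm x"
  by (rule antisym; rule norm_mono_abs; simp)

lemma nonneg_limit_banach_lattice:
  fixes x :: "nat \<Rightarrow> 'a::banach_lattice"
  assumes lim: "x \<longlonglongrightarrow> l" and nonneg: "\<And>n. 0 \<le> x n"
  shows "0 \<le> l"
proof -
  define m where "m = sup (- l) 0"
  have m0: "0 \<le> m" by (simp add: m_def)
  have "norm m \<le> norm (x n - l)" for n
  proof (rule norm_mono_abs)
    have "- l \<le> x n - l" using nonneg[of n] by simp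
    also have "\<dots> \<le> \<bar>x n - l\<bar>" by (rule abs_ge_self)
    finally have "m \<le> \<bar>x n - l\<bar>" by (simp add: m_def)
    then show "\<bar>m\<bar> \<le> \<bar>x n - l\<bar>" using m0 by simp
  qed
  moreover have "(\<lambda>n. norm (x n - l)) \<longlonglongrightarrow> 0"
    using lim LIM_zero tendsto_norm_zero by blast
  ultimately have "norm m \<le> 0"
    by (intro LIMSEQ_le_const) auto
  then have "m = 0" by simp
  then have "- l \<le> 0" unfolding m_def by (metis sup_ge1)
  then show ?thesis by simp
qed

lemma le_limit_banach_lattice:
  fixes x :: "nat \<Rightarrow> 'a::banach_lattice"
  assumes "x \<longlonglongrightarrow> l" "y \<longlonglongrightarrow> m" "\<And>n. x n \<le> y n"
  shows "l \<le> m"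
  using nonneg_limit_banach_lattice[OF tendsto_diff[OF assms(2,1)]] assms(3) by simp

lemma scaleR_le_abs:
  fixes x :: "'a::banach_lattice"
  shows "a *\<^sub>R x \<le> \<bar>a\<bar> *\<^sub>R \<bar>x\<bar>"
proof (cases "a \<ge> 0")
  case True
  then show ?thesis using scaleR_left_mono[OF abs_ge_self[of x]] by simp
next
  case False
  then have "(-a) *\<^sub>R (-x) \<le> (-a) *\<^sub>R \<bar>x\<bar>"
    by (intro scaleR_left_mono) (auto simp: abs_ge_minus_self)
  then show ?thesis using False by simp
qed

lemma re_part_scaleC_le:
  fixes z :: "'a::banach_lattice complexification"
  shows "re_part (c *\<^sub>C z) \<le> norm c *\<^sub>R (\<bar>re_part z\<bar> + \<bar>im_part z\<bar>)"
proof -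
  have "Re c *\<^sub>R re_part z \<le> norm c *\<^sub>R \<bar>re_part z\<bar>"
    by (rule order_trans[OF scaleR_le_abs scaleR_right_mono]) (auto simp: abs_Re_le_cmod)
  moreover have "(- Im c) *\<^sub>R im_part z \<le> norm c *\<^sub>R \<bar>im_part z\<bar>"
    by (rule order_trans[OF scaleR_le_abs scaleR_right_mono]) (auto simp: abs_Im_le_cmod)
  ultimately have "Re c *\<^sub>R re_part z + (- Im c) *\<^sub>R im_part z
      \<le> norm c *\<^sub>R \<bar>re_part z\<bar> + norm c *\<^sub>R \<bar>im_part z\<bar>" by (rule add_mono)
  then show ?thesis by (simp add: scaleR_add_right)
qed

lemma is_modulus_exists:
  fixes z :: "'a::banach_lattice complexification"
  shows "\<exists>m. is_modulus z m"
proof -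
  define u where "u = \<bar>re_part z\<bar> + \<bar>im_part z\<bar>"
  have u0: "0 \<le> u" by (simp add: u_def)
  define \<delta> where "\<delta> n = inverse (real (Suc n))" for n
  have \<delta>0: "0 < \<delta> n" for n by (simp add: \<delta>_def)
  have "\<exists>K. finite K \<and> K \<subseteq> sphere (0::complex) 1 \<and> sphere 0 1 \<subseteq> (\<Union>x\<in>K. ball x (\<delta> n))" for n
    using seq_compact_imp_totally_bounded[of "sphere (0::complex) 1"] \<delta>0
    by (simp add: compact_eq_seq_compact_metric[symmetric])
  then obtain K where K: "finite (K n)" "K n \<subseteq> sphere (0::complex) 1"
      "sphere 0 1 \<subseteq> (\<Union>x\<in>K n. ball x (\<delta> n))" for n by metis
  have K0: "K n \<noteq> {}" for n
    using K(3)[of n] by (metis SUP_empty dist_0_norm ex_in_conv mem_sphere norm_one subset_empty)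
  define s where "s n = Sup_fin ((\<lambda>c. re_part (c *\<^sub>C z)) ` K n)" for n
  have s_ub: "re_part (c *\<^sub>C z) \<le> s n + \<delta> n *\<^sub>R u" if "norm c = 1" for c n
  proof -
    have "c \<in> (\<Union>x\<in>K n. ball x (\<delta> n))"
      by (rule subsetD[OF K(3)]) (use that in simp)
    then obtain k where k: "k \<in> K n" "dist k c < \<delta> n" by auto
    have "re_part (c *\<^sub>C z) = re_part (k *\<^sub>C z) + re_part ((c - k) *\<^sub>C z)"
      by (simp add: algebra_simps)
    also have "re_part (k *\<^sub>C z) \<le> s n"
      unfolding s_def using K(1) k(1) by (intro Sup_fin.coboundedI) auto
    also have "re_part ((c - k) *\<^sub>C z) \<le> norm (c - k) *\<^sub>R u"
      unfolding u_def by (rule re_part_scaleC_le)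
    also have "norm (c - k) *\<^sub>R u \<le> \<delta> n *\<^sub>R u"
      using k(2) u0 by (intro scaleR_right_mono) (auto simp: dist_norm norm_minus_commute)
    finally show ?thesis by simp
  qed
  have s_least: "s n \<le> v" if "\<And>c. norm c = 1 \<Longrightarrow> re_part (c *\<^sub>C z) \<le> v" for n v
    unfolding s_def using K(1,2)[of n] K0[of n] that
    by (intro Sup_fin.boundedI) (auto simp: subset_iff)
  have s_close: "s m \<le> s n + \<delta> n *\<^sub>R u" for m n
    by (rule s_least) (rule s_ub)
  have norm_s: "norm (s m - s n) \<le> (\<delta> m + \<delta> n) * norm u" for m n
  proof -
    have "s m - s n \<le> \<delta> n *\<^sub>R u" "s n - s m \<le> \<delta> m *\<^sub>R u"
      using s_close[of m n] s_close[of n m] by (simp_all add: algebra_simps)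
    moreover have "\<delta> n *\<^sub>R u \<le> (\<delta> m + \<delta> n) *\<^sub>R u" "\<delta> m *\<^sub>R u \<le> (\<delta> m + \<delta> n) *\<^sub>R u"
      using u0 \<delta>0[of m] \<delta>0[of n] by (auto intro!: scaleR_right_mono)
    ultimately have "\<bar>s m - s n\<bar> \<le> (\<delta> m + \<delta> n) *\<^sub>R u"
      by (intro abs_leI) (auto intro: order_trans)
    also have "\<dots> \<le> \<bar>(\<delta> m + \<delta> n) *\<^sub>R u\<bar>" by (rule abs_ge_self)
    finally have "norm (s m - s n) \<le> norm ((\<delta> m + \<delta> n) *\<^sub>R u)" by (rule norm_mono_abs)
    also have "\<dots> = (\<delta> m + \<delta> n) * norm u" using \<delta>0[of m] \<delta>0[of n] by simp
    finally show ?thesis .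
  qed
  have \<delta>_lim: "\<delta> \<longlonglongrightarrow> 0" unfolding \<delta>_def by (rule LIMSEQ_inverse_real_of_nat)
  have "Cauchy s"
  proof (rule metric_CauchyI)
    fix e :: real assume e: "e > 0"
    have "(\<lambda>n. 2 * \<delta> n * norm u) \<longlonglongrightarrow> 2 * 0 * norm u"
      by (intro tendsto_intros \<delta>_lim)
    then have "\<forall>\<^sub>F n in sequentially. 2 * \<delta> n * norm u < e"
      using e by (intro order_tendstoD(2)[where y = 0]) auto
    then obtain N where N: "2 * \<delta> N * norm u < e" by (auto simp: eventually_sequentially)
    have "dist (s m) (s n) < e" if "m \<ge> N" "n \<ge> N" for m n
    proof -
      have "\<delta> m \<le> \<delta> N" "\<delta> n \<le> \<delta> N" using that by (auto simp: \<delta>_def field_simps)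
      then have "(\<delta> m + \<delta> n) * norm u \<le> 2 * \<delta> N * norm u"
        by (intro mult_right_mono) auto
      then show ?thesis using norm_s[of m n] N by (simp add: dist_norm)
    qed
    then show "\<exists>M. \<forall>m\<ge>M. \<forall>n\<ge>M. dist (s m) (s n) < e" by blast
  qed
  then obtain l where l: "s \<longlonglongrightarrow> l" using Cauchy_convergent convergent_def by blast
  have l': "(\<lambda>n. s n + \<delta> n *\<^sub>R u) \<longlonglongrightarrow> l"
    using tendsto_add[OF l tendsto_scaleR[OF \<delta>_lim tendsto_const]] by simp
  have "is_modulus z l"
    unfolding is_modulus_def
  proof (intro conjI allI impI)
    fix c :: complex assume "norm c = 1"
    then show "re_part (c *\<^sub>C z) \<le> l"
      by (intro le_limit_banach_lattice[OF tendsto_const l'] s_ub)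
  next
    fix v assume "\<forall>c. norm c = 1 \<longrightarrow> re_part (c *\<^sub>C z) \<le> v"
    then show "l \<le> v"
      by (intro le_limit_banach_lattice[OF l tendsto_const] s_least) auto
  qed
  then show ?thesis by blast
qed

lemma is_modulus_modulus: "is_modulus z (modulus z)"
proof -
  have "\<exists>!m. is_modulus z m"
    using is_modulus_exists[of z] by (auto simp: is_modulus_def intro: antisym)
  then show ?thesis unfolding modulus_def by (rule theI')
qed

lemma re_part_scaleC_le_modulus: "norm c = 1 \<Longrightarrow> re_part (c *\<^sub>C z) \<le> modulus z"
  using is_modulus_modulus[of z] by (simp add: is_modulus_def)

lemma modulus_least: "(\<And>c. norm c = 1 \<Longrightarrow> re_part (c *\<^sub>C z) \<le> v) \<Longrightarrow> modulus z \<le> v"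
  using is_modulus_modulus[of z] by (simp add: is_modulus_def)

lemma abs_re_part_le_modulus: "\<bar>re_part z\<bar> \<le> modulus z"
  using re_part_scaleC_le_modulus[of 1 z] re_part_scaleC_le_modulus[of "-1" z]
  by (auto intro!: abs_leI)

lemma abs_im_part_le_modulus: "\<bar>im_part z\<bar> \<le> modulus z"
  using re_part_scaleC_le_modulus[of \<i> z] re_part_scaleC_le_modulus[of "-\<i>" z]
  by (auto intro!: abs_leI)

lemma modulus_nonneg: "0 \<le> modulus z"
  using abs_re_part_le_modulus[of z] abs_ge_zero order_trans by blast

lemma modulus_triangle: "modulus (z + w) \<le> modulus z + modulus w"
proof (rule modulus_least)
  fix c :: complex assume "norm c = 1"
  then have "re_part (c *\<^sub>C z) + re_part (c *\<^sub>C w) \<le> modulus z + modulus w"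
    by (intro add_mono re_part_scaleC_le_modulus)
  then show "re_part (c *\<^sub>C (z + w)) \<le> modulus z + modulus w"
    by (simp add: algebra_simps)
qed

lemma modulus_le_abs_parts: "modulus z \<le> \<bar>re_part z\<bar> + \<bar>im_part z\<bar>"
  by (rule modulus_least) (metis re_part_scaleC_le scaleR_one)

lemma modulus_zero [simp]: "modulus 0 = 0"
  by (rule antisym) (use modulus_le_abs_parts[of 0] modulus_nonneg[of 0] in simp_all)

lemma modulus_scaleC_le: "modulus (c *\<^sub>C z) \<le> norm c *\<^sub>R modulus z"
proof (rule modulus_least)
  fix d :: complex assume d: "norm d = 1"
  show "re_part (d *\<^sub>C c *\<^sub>C z) \<le> norm c *\<^sub>R modulus z"
  proof (cases "c = 0")
    case False
    define b where "b = d * c / norm c"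
    have b: "norm b = 1" "d * c = of_real (norm c) * b"
      using False d by (auto simp: b_def norm_mult norm_divide)
    have "re_part (d *\<^sub>C c *\<^sub>C z) = norm c *\<^sub>R re_part (b *\<^sub>C z)"
      by (simp only: scaleC_scaleC b(2)) (simp add: algebra_simps)
    also have "\<dots> \<le> norm c *\<^sub>R modulus z"
      by (intro scaleR_left_mono re_part_scaleC_le_modulus b) auto
    finally show ?thesis .
  qed auto
qed

lemma modulus_scaleC: "modulus (c *\<^sub>C z) = norm c *\<^sub>R modulus z"
proof (cases "c = 0")
  case True
  then have "c *\<^sub>C z = 0" by (simp add: complexification_eq_iff)
  then show ?thesis using True by simp
next
  case False
  have "modulus z = modulus (inverse c *\<^sub>C c *\<^sub>C z)"
    using False by (simp add: scaleC_scaleC scaleC_one)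
  also have "\<dots> \<le> norm (inverse c) *\<^sub>R modulus (c *\<^sub>C z)" by (rule modulus_scaleC_le)
  finally have "norm c *\<^sub>R modulus z \<le> norm c *\<^sub>R norm (inverse c) *\<^sub>R modulus (c *\<^sub>C z)"
    by (rule scaleR_left_mono) auto
  then have "norm c *\<^sub>R modulus z \<le> modulus (c *\<^sub>C z)"
    using False by (simp add: norm_inverse)
  with modulus_scaleC_le show ?thesis by (rule antisym)
qed

instantiation complexification :: (banach_lattice) complex_normed_vector
begin

definition norm_complexification :: "'a complexification \<Rightarrow> real" where
  "norm_complexification z = norm (modulus z)"
definition sgn_complexification :: "'a complexification \<Rightarrow> 'a complexification" where
  "sgn_complexification z = z /\<^sub>R norm z"
definition dist_complexification :: "'a complexification \<Rightarrow> 'a complexification \<Rightarrow> real" where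
  "dist_complexification z w = norm (z - w)"
definition uniformity_complexification :: "('a complexification \<times> 'a complexification) filter" where
  "uniformity_complexification = (INF e\<in>{0 <..}. principal {(z, w). dist z w < e})"
definition open_complexification :: "'a complexification set \<Rightarrow> bool" where
  "open_complexification U \<longleftrightarrow>
     (\<forall>z\<in>U. eventually (\<lambda>(z', w). z' = z \<longrightarrow> w \<in> U) uniformity)"

instance
proof
  fix r :: real and c :: complex and z w :: "'a complexification"
  show "norm z = 0 \<longleftrightarrow> z = 0"
  proof
    assume "norm z = 0"
    then have "modulus z = 0" by (simp add: norm_complexification_def)
    then show "z = 0"
      using abs_re_part_le_modulus[of z] abs_im_part_le_modulus[of z]
      by (simp add: complexification_eq_iff)
  qed (simp add: norm_complexification_def)
  show "norm (z + w) \<le> norm z + norm w"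
  proof -
    have "norm (modulus (z + w)) \<le> norm (modulus z + modulus w)"
      by (rule norm_mono_abs) (simp add: modulus_nonneg modulus_triangle)
    also have "\<dots> \<le> norm (modulus z) + norm (modulus w)" by (rule norm_triangle_ineq)
    finally show ?thesis by (simp add: norm_complexification_def)
  qed
  show "norm (c *\<^sub>C z) = norm c * norm z"
    by (simp add: norm_complexification_def modulus_scaleC)
  show "norm (r *\<^sub>R z) = \<bar>r\<bar> * norm z"
    by (simp only: scaleR_scaleC norm_complexification_def modulus_scaleC) simp
qed (rule sgn_complexification_def dist_complexification_def
    uniformity_complexification_def open_complexification_def)+

end

lemma norm_re_part_le: "norm (re_part z) \<le> norm z"
  unfolding norm_complexification_def
  by (rule norm_mono_abs) (simp add: modulus_nonneg abs_re_part_le_modulus)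

lemma norm_im_part_le: "norm (im_part z) \<le> norm z"
  unfolding norm_complexification_def
  by (rule norm_mono_abs) (simp add: modulus_nonneg abs_im_part_le_modulus)

lemma norm_complexification_le: "norm z \<le> norm (re_part z) + norm (im_part z)"
proof -
  have "norm (modulus z) \<le> norm (\<bar>re_part z\<bar> + \<bar>im_part z\<bar>)"
    by (rule norm_mono_abs) (simp add: modulus_nonneg modulus_le_abs_parts)
  also have "\<dots> \<le> norm \<bar>re_part z\<bar> + norm \<bar>im_part z\<bar>" by (rule norm_triangle_ineq)
  finally show ?thesis by (simp add: norm_complexification_def norm_abs_banach_lattice)
qed

instance complexification :: (banach_lattice) complex_banach
proof
  fix X :: "nat \<Rightarrow> 'a complexification"
  assume X: "Cauchy X"
  have "Cauchy (\<lambda>n. re_part (X n))"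
    unfolding Cauchy_iff
  proof (intro allI impI)
    fix e :: real assume "e > 0"
    with X obtain M where M: "\<And>m n. m \<ge> M \<Longrightarrow> n \<ge> M \<Longrightarrow> norm (X m - X n) < e"
      unfolding Cauchy_iff by blast
    have "norm (re_part (X m) - re_part (X n)) < e" if "m \<ge> M" "n \<ge> M" for m n
      using norm_re_part_le[of "X m - X n"] M[OF that] by simp
    then show "\<exists>M. \<forall>m\<ge>M. \<forall>n\<ge>M. norm (re_part (X m) - re_part (X n)) < e" by blast
  qed
  then obtain x where x: "(\<lambda>n. re_part (X n)) \<longlonglongrightarrow> x"
    using Cauchy_convergent convergent_def by blast
  have "Cauchy (\<lambda>n. im_part (X n))"
    unfolding Cauchy_iff
  proof (intro allI impI)
    fix e :: real assume "e > 0"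
    with X obtain M where M: "\<And>m n. m \<ge> M \<Longrightarrow> n \<ge> M \<Longrightarrow> norm (X m - X n) < e"
      unfolding Cauchy_iff by blast
    have "norm (im_part (X m) - im_part (X n)) < e" if "m \<ge> M" "n \<ge> M" for m n
      using norm_im_part_le[of "X m - X n"] M[OF that] by simp
    then show "\<exists>M. \<forall>m\<ge>M. \<forall>n\<ge>M. norm (im_part (X m) - im_part (X n)) < e" by blast
  qed
  then obtain y where y: "(\<lambda>n. im_part (X n)) \<longlonglongrightarrow> y"
    using Cauchy_convergent convergent_def by blast
  define l where "l = Complexification x y"
  have lim: "(\<lambda>n. norm (re_part (X n) - x) + norm (im_part (X n) - y)) \<longlonglongrightarrow> 0"
    using tendsto_add[OF tendsto_norm_zero[OF LIM_zero[OF x]] tendsto_norm_zero[OF LIM_zero[OF y]]]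
    by simp
  have "norm (X n - l) \<le> norm (re_part (X n) - x) + norm (im_part (X n) - y)" for n
    using norm_complexification_le[of "X n - l"] by (simp add: l_def)
  then have "(\<lambda>n. X n - l) \<longlonglongrightarrow> 0"
    by (intro Lim_null_comparison[OF _ lim] always_eventually) simp
  then have "X \<longlonglongrightarrow> l" by (rule LIM_zero_cancel)
  then show "convergent X" by (auto simp: convergent_def)
qed


section \<open>Lattice notions and semigroups on complex Banach lattices\<close>

definition lattice_ideal :: "'a::banach_lattice complexification set \<Rightarrow> bool" where
  "lattice_ideal I \<longleftrightarrow> csubspace I \<and> (\<forall>f g. g \<in> I \<longrightarrow> \<bar>f\<bar> \<le> \<bar>g\<bar> \<longrightarrow> f \<in> I)"

definition principal_ideal :: "'a::banach_lattice complexification \<Rightarrow> 'a complexification set" where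
  "principal_ideal u = {f. \<exists>c::real. c > 0 \<and> \<bar>f\<bar> \<le> c *\<^sub>R u}"

definition quasi_interior_point :: "'a::banach_lattice complexification \<Rightarrow> bool" where
  "quasi_interior_point u \<longleftrightarrow> 0 \<le> u \<and> closure (principal_ideal u) = UNIV"

definition positive_functional ::
    "('a::banach_lattice complexification \<Rightarrow>\<^sub>L complex) \<Rightarrow> bool" where
  "positive_functional \<phi> \<longleftrightarrow> \<phi> \<in> dual_space \<and> (\<forall>f\<ge>0. blinfun_apply \<phi> f \<in> \<real>\<^sub>\<ge>\<^sub>0)"

definition strictly_positive_functional ::
    "('a::banach_lattice complexification \<Rightarrow>\<^sub>L complex) \<Rightarrow> bool" where
  "strictly_positive_functional \<phi> \<longleftrightarrow>
     positive_functional \<phi> \<and> (\<forall>f\<ge>0. blinfun_apply \<phi> f = 0 \<longrightarrow> f = 0)"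

definition real_semigroup ::
    "(real \<Rightarrow> 'a::banach_lattice complexification \<Rightarrow> 'a complexification) \<Rightarrow> bool" where
  "real_semigroup T \<longleftrightarrow> (\<forall>t\<ge>0. T t ` real_subspace \<subseteq> real_subspace)"

definition individually_eventually_positive ::
    "(real \<Rightarrow> 'a::banach_lattice complexification \<Rightarrow> 'a complexification) \<Rightarrow> bool" where
  "individually_eventually_positive T \<longleftrightarrow> (\<forall>f\<ge>0. \<exists>t0\<ge>0. \<forall>t\<ge>t0. T t f \<ge> 0)"

definition persistently_irreducible ::
    "(real \<Rightarrow> 'a::banach_lattice complexification \<Rightarrow> 'a complexification) \<Rightarrow> bool" where
  "persistently_irreducible T \<longleftrightarrow>
     (\<forall>I. closed I \<longrightarrow> lattice_ideal I \<longrightarrow> (\<exists>t0\<ge>0. \<forall>t\<ge>t0. T t ` I \<subseteq> I) \<longrightarrow>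
       I = {0} \<or> I = UNIV)"

end

theory Submission
  imports Defs
begin

text \<open>After rescaling \<open>T\<close> by \<open>exp (- \<mu> t)\<close> we may take \<open>\<mu> = 0\<close>. Since the null ideal of the
  positive invariant functional \<open>\<phi>\<close> is eventually invariant vector by vector, Baire's theorem
  makes it persistently invariant, and irreducibility forces \<open>\<phi>\<close> to be strictly positive.
  For a real fixed vector \<open>x\<close> one eventually has \<open>T t \<bar>x\<bar> \<ge> \<bar>x\<bar>\<close>, and \<open>\<phi>\<close> sees no difference,
  so the real fixed space is a sublattice. A positive fixed vector \<open>f \<noteq> 0\<close> eventually keeps every
  vector of the order interval \<open>[- f, f]\<close> inside that interval; Baire's theorem on \<open>[- f, f]\<close> shows
  that the closed ideal generated by \<open>f\<close> is persistently invariant, so \<open>f\<close> is quasi-interior.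
  Hence positive and negative parts of a fixed vector, being disjoint, cannot both be non-zero;
  applied to \<open>g - (\<phi> g / \<phi> f) f\<close>, which \<open>\<phi>\<close> annihilates, this makes the fixed space
  one-dimensional. Finally \<open>\<phi>\<close> annihilates the range of the generator but not \<open>f\<close>, which
  excludes generalised eigenvectors.\<close>

section \<open>Consequences of Baire's theorem\<close>

text \<open>Baire's theorem in \<open>C\<close> with its relative topology: were every
  \<open>C \<inter> F n\<close> without relative interior, so would be their union \<open>C\<close>.
  Working relative to \<open>C\<close> matters because an order interval may have empty interior in
  the whole space.\<close>

lemma Baire_closed_cover:
  fixes C :: "'a::banach set" and F :: "nat \<Rightarrow> 'a set"
  assumes "closed C" "C \<noteq> {}" "\<And>n. closed (F n)" "C \<subseteq> (\<Union>n. F n)"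
  obtains n x r where "r > 0" "x \<in> C" "C \<inter> ball x r \<subseteq> F n"
proof -
  let ?X = "top_of_set C"
  have "\<exists>n. ?X interior_of (C \<inter> F n) \<noteq> {}"
  proof (rule ccontr)
    assume "\<not> ?thesis"
    then have "?X interior_of \<Union> (range (\<lambda>n. C \<inter> F n)) = {}"
      using assms(1,3)
      by (intro Baire_category_alt)
        (auto simp: closedin_closed_Int completely_metrizable_space_closedin
          completely_metrizable_space_euclidean)
    moreover have "\<Union> (range (\<lambda>n. C \<inter> F n)) = topspace ?X"
      using assms(4) by auto
    ultimately show False using assms(2) by (metis interior_of_topspace topspace_euclidean_subtopology)
  qed
  then obtain n x where x: "x \<in> ?X interior_of (C \<inter> F n)" by blast
  then obtain U where U: "openin ?X U" "x \<in> U" "U \<subseteq> C \<inter> F n"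
    unfolding interior_of_def by blast
  then obtain V where V: "open V" "U = C \<inter> V" unfolding openin_open by blast
  then obtain r where "r > 0" "ball x r \<subseteq> V"
    using U(2) by (meson IntD2 open_contains_ball)
  then show thesis using that[of r x n] U V by blast
qed

text \<open>Turns a time depending on the vector into a common one. The sets \<open>F n\<close> of
  vectors whose images stay in \<open>J\<close> from time \<open>n\<close> on cover
  \<open>C\<close>, so one of them contains a relative ball about some \<open>x\<close>. Any
  \<open>y\<close> in \<open>C\<close> is pulled along the segment towards \<open>x\<close> into
  that ball, and linearity recovers \<open>R t y\<close> from the images of the two points.\<close>

lemma Baire_eventually_into_subspace:
  fixes R :: "real \<Rightarrow> 'a::banach \<Rightarrow> 'a"
  assumes lin: "\<And>t. t \<ge> 0 \<Longrightarrow> bounded_linear (R t)"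
    and C: "closed C" "convex C"
    and J: "closed J" "subspace J"
    and ev: "\<And>x. x \<in> C \<Longrightarrow> \<exists>t0\<ge>0. \<forall>t\<ge>t0. R t x \<in> J"
  shows "\<exists>t0\<ge>0. \<forall>t\<ge>t0. R t ` C \<subseteq> J"
proof (cases "C = {}")
  case False
  define F where "F n = (\<Inter>t\<in>{real n..}. {x. R t x \<in> J})" for n
  have "closed (F n)" for n
    unfolding F_def
  proof (intro closed_INT ballI)
    fix t assume "t \<in> {real n..}"
    then have "continuous_on UNIV (R t)"
      by (intro linear_continuous_on lin) auto
    then show "closed {x. R t x \<in> J}"
      using continuous_closed_vimage[OF J(1), of "R t"]
      by (simp add: vimage_def continuous_on_eq_continuous_at)
  qed
  moreover have "C \<subseteq> (\<Union>n. F n)"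
  proof
    fix x assume "x \<in> C"
    then obtain t0 where t0: "\<forall>t\<ge>t0. R t x \<in> J" using ev by blast
    obtain n :: nat where "real n \<ge> t0" using real_arch_simple by blast
    then have "x \<in> F n" using t0 by (auto simp: F_def)
    then show "x \<in> (\<Union>n. F n)" by blast
  qed
  ultimately obtain n x r where r: "r > 0" "x \<in> C" "C \<inter> ball x r \<subseteq> F n"
    using Baire_closed_cover[OF C(1) False] by metis
  have "R t y \<in> J" if y: "y \<in> C" and t: "t \<ge> real n" for y t
  proof -
    interpret bounded_linear "R t" using lin t by simp
    \<comment> \<open>A fraction of the segment short enough to stay in the ball; the
      \<open>+ 1\<close> keeps it positive when \<open>y = x\<close>.\<close>
    define e where "e = min 1 (r / (2 * (norm (y - x) + 1)))"
    have e: "0 < e" "e \<le> 1" "e * norm (y - x) < r"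
    proof -
      have p: "0 < r / (2 * (norm (y - x) + 1))"
        using r(1) by (intro divide_pos_pos) (auto intro: add_nonneg_pos)
      then show "0 < e" "e \<le> 1" by (auto simp: e_def)
      have "e * norm (y - x) \<le> r / (2 * (norm (y - x) + 1)) * norm (y - x)"
        by (intro mult_right_mono) (auto simp: e_def)
      also have "\<dots> \<le> r / (2 * (norm (y - x) + 1)) * (norm (y - x) + 1)"
        using p by (intro mult_left_mono) auto
      also have "\<dots> = r / 2" using norm_ge_zero[of "y - x"]
        by (simp add: field_simps add_nonneg_eq_0_iff)
      finally show "e * norm (y - x) < r" using r(1) by simp
    qed
    have "(1 - e) *\<^sub>R x + e *\<^sub>R y \<in> C"
      using C(2) r(2) y e by (simp add: convexD)
    moreover have eq: "(1 - e) *\<^sub>R x + e *\<^sub>R y = x + e *\<^sub>R (y - x)"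
      by (simp add: algebra_simps)
    moreover have "x + e *\<^sub>R (y - x) \<in> ball x r"
      using e by (simp add: dist_norm)
    ultimately have "x + e *\<^sub>R (y - x) \<in> F n" using r(3) by auto
    moreover have "x \<in> F n" using r by auto
    ultimately have "R t (x + e *\<^sub>R (y - x)) \<in> J" "R t x \<in> J"
      using t by (auto simp: F_def)
    moreover have "R t y = R t x + (1 / e) *\<^sub>R (R t (x + e *\<^sub>R (y - x)) - R t x)"
      using e by (simp add: add scaleR diff)
    ultimately show ?thesis
      using J(2) by (simp add: subspace_add subspace_diff subspace_scale)
  qed
  then show ?thesis by (intro exI[of _ "real n"]) auto
qed auto

section \<open>Strongly continuous semigroups\<close>

locale c0_semigroup =
  fixes S :: "real \<Rightarrow> 'a::complex_banach \<Rightarrow> 'a"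
  assumes C0: "C0_semigroup S"
begin

section \<open>Local boundedness and continuity of orbits, and the generator\<close>

lemma clinear: "t \<ge> 0 \<Longrightarrow> bounded_clinear (S t)"
  using C0 by (simp add: C0_semigroup_def)

lemma linear: "t \<ge> 0 \<Longrightarrow> bounded_linear (S t)"
  using clinear by (simp add: bounded_clinear_def)

lemma zero: "S 0 f = f"
  using C0 by (simp add: C0_semigroup_def)

lemma add: "s \<ge> 0 \<Longrightarrow> t \<ge> 0 \<Longrightarrow> S (s + t) f = S s (S t f)"
  using C0 by (simp add: C0_semigroup_def fun_eq_iff)

lemma lim: "((\<lambda>t. S t f) \<longlongrightarrow> f) (at_right 0)"
  using C0 by (simp add: C0_semigroup_def)

text \<open>A uniform boundedness argument in which the time interval shrinks as the bound grows.
  \<open>F n\<close> leaves out time \<open>0\<close>, about which the right-hand limit says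
  nothing; there the operator is the identity and \<open>M \<ge> 1\<close> suffices.\<close>

lemma bound_near_0:
  obtains M \<delta> where "\<delta> > 0" "M \<ge> 1" "\<And>t f. 0 \<le> t \<Longrightarrow> t \<le> \<delta> \<Longrightarrow> norm (S t f) \<le> M * norm f"
proof -
  define d where "d n = inverse (real (Suc n))" for n
  define F where "F n = (\<Inter>t\<in>{0<..d n}. {f. norm (S t f) \<le> real n})" for n
  have "closed (F n)" for n
    unfolding F_def
    by (intro closed_INT ballI closed_Collect_le continuous_intros
        bounded_linear.continuous_on[OF linear]) auto
  moreover have "UNIV \<subseteq> (\<Union>n. F n)"
  proof
    fix f :: 'a
    have "eventually (\<lambda>t. norm (S t f) < norm f + 1) (at_right 0)"
      by (rule order_tendstoD(2)[OF tendsto_norm[OF lim]]) simp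
    then obtain b where b: "b > 0" "\<And>t. 0 < t \<Longrightarrow> t < b \<Longrightarrow> norm (S t f) < norm f + 1"
      unfolding eventually_at_right_field by blast
    obtain n1 :: nat where n1: "real n1 \<ge> norm f + 1" using real_arch_simple by blast
    obtain n2 where n2: "inverse (real (Suc n2)) < b" using reals_Archimedean[OF b(1)] by blast
    define n where "n = max n1 n2"
    have "d n \<le> inverse (real (Suc n2))" by (simp add: d_def n_def)
    then have "d n < b" using n2 by linarith
    moreover have "real n \<ge> norm f + 1" using n1 by (simp add: n_def)
    ultimately have "f \<in> F n" using b(2) by (fastforce simp: F_def)
    then show "f \<in> (\<Union>n. F n)" by blast
  qed
  ultimately obtain n x r where r: "r > 0" "UNIV \<inter> ball x r \<subseteq> F n"
    using Baire_closed_cover[of UNIV F] closed_UNIV UNIV_not_empty by metis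
  \<comment> \<open>For \<open>c = r / (2 * norm f)\<close> both \<open>x\<close> and
    \<open>x + c *\<^sub>R f\<close> lie in the ball, so the image of \<open>c *\<^sub>R f\<close>
    has norm at most \<open>2 * n\<close>; dividing by \<open>c\<close> gives the factor
    \<open>4 * n / r\<close>.\<close>
  define M where "M = max 1 (4 * real n / r)"
  have bnd: "norm (S t f) \<le> M * norm f" if t: "0 < t" "t \<le> d n" for t f
  proof (cases "f = 0")
    case True
    then show ?thesis using linear_0[OF bounded_linear.linear[OF linear]] t by simp
  next
    case False
    interpret bounded_linear "S t" using linear t by simp
    define c where "c = r / (2 * norm f)"
    have c: "c > 0" using r False by (simp add: c_def)
    have "x \<in> F n" "x + c *\<^sub>R f \<in> F n"
      using r c False by (auto intro!: subsetD[OF r(2)] simp: dist_norm c_def)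
    then have "norm (S t x) \<le> n" "norm (S t (x + c *\<^sub>R f)) \<le> n"
      using t by (auto simp: F_def)
    moreover have "S t (c *\<^sub>R f) = S t (x + c *\<^sub>R f) - S t x" by (simp add: add)
    ultimately have "norm (S t (c *\<^sub>R f)) \<le> 2 * real n"
      using norm_triangle_ineq4[of "S t (x + c *\<^sub>R f)" "S t x"] by simp
    then have "c * norm (S t f) \<le> 2 * real n" using c by (simp add: scaleR)
    then have "norm (S t f) \<le> (4 * real n / r) * norm f"
      using r False by (simp add: c_def field_simps)
    also have "\<dots> \<le> M * norm f" by (intro mult_right_mono) (auto simp: M_def)
    finally show ?thesis .
  qed
  show thesis
  proof (rule that[of "d n" M])
    fix t f assume "0 \<le> t" "t \<le> d n"
    then show "norm (S t f) \<le> M * norm f"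
      using bnd[of t f] mult_right_mono[of 1 M "norm f"]
      by (cases "t = 0") (auto simp: zero M_def)
  qed (auto simp: d_def M_def)
qed

text \<open>By the semigroup law, \<open>k + 1\<close> steps of length at most
  \<open>\<delta>\<close> reach every time up to \<open>b\<close>, each costing a factor
  \<open>M\<close>.\<close>

lemma locally_bounded:
  obtains M where "M \<ge> 1" "\<And>t f. 0 \<le> t \<Longrightarrow> t \<le> b \<Longrightarrow> norm (S t f) \<le> M * norm f"
proof -
  obtain M \<delta> where M: "\<delta> > 0" "M \<ge> 1" "\<And>t f. 0 \<le> t \<Longrightarrow> t \<le> \<delta> \<Longrightarrow> norm (S t f) \<le> M * norm f"
    using bound_near_0 by metis
  have *: "norm (S t f) \<le> M ^ Suc k * norm f" if "0 \<le> t" "t \<le> real (Suc k) * \<delta>" for k t f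
    using that
  proof (induction k arbitrary: t)
    case 0
    then show ?case using M(3) by simp
  next
    case (Suc k)
    show ?case
    proof (cases "t \<le> \<delta>")
      case True
      have "norm (S t f) \<le> M * norm f" using M(3) Suc.prems True by simp
      also have "\<dots> \<le> M ^ Suc (Suc k) * norm f"
        using M(2) self_le_power[of M "Suc (Suc k)"] by (intro mult_right_mono) auto
      finally show ?thesis .
    next
      case False
      have "S t f = S \<delta> (S (t - \<delta>) f)"
        using add[of \<delta> "t - \<delta>" f] False M(1) by simp
      then have "norm (S t f) \<le> M * norm (S (t - \<delta>) f)" using M by simp
      also have "\<dots> \<le> M * (M ^ Suc k * norm f)"
        using Suc.prems False M by (intro mult_left_mono Suc.IH) (auto simp: algebra_simps)
      finally show ?thesis by simp
    qed
  qed
  obtain k :: nat where k: "b / \<delta> \<le> real k" using real_arch_simple by blast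
  show thesis
  proof (rule that[of "M ^ Suc k"])
    show "M ^ Suc k \<ge> 1" using M(2) by (rule one_le_power)
    fix t f assume t: "0 \<le> t" "t \<le> b"
    have "b \<le> real (Suc k) * \<delta>" using k M(1) by (simp add: field_simps)
    then show "norm (S t f) \<le> M ^ Suc k * norm f" using t by (intro *) auto
  qed
qed

text \<open>For \<open>s \<le> t\<close> the increment is \<open>S s\<close> applied to
  \<open>S (t - s) f - f\<close>. Right-hand information at time \<open>0\<close> thereby yields
  two-sided estimates at every time.\<close>

lemma increment_bound:
  obtains M where "M \<ge> 1" "\<And>s t f. 0 \<le> s \<Longrightarrow> s \<le> b \<Longrightarrow> 0 \<le> t \<Longrightarrow> t \<le> b \<Longrightarrow>
     norm (S t f - S s f) \<le> M * norm (S \<bar>t - s\<bar> f - f)"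
proof -
  obtain M where M: "M \<ge> 1" "\<And>t f. 0 \<le> t \<Longrightarrow> t \<le> b \<Longrightarrow> norm (S t f) \<le> M * norm f"
    using locally_bounded[of b] by metis
  have *: "norm (S t f - S s f) \<le> M * norm (S (t - s) f - f)"
    if "0 \<le> s" "s \<le> t" "t \<le> b" for s t f
  proof -
    have "S t f - S s f = S s (S (t - s) f - f)"
      using add[of s "t - s" f] that by (simp add: linear_diff[OF bounded_linear.linear[OF linear]])
    then show ?thesis using M(2)[of s "S (t - s) f - f"] that by simp
  qed
  show thesis
  proof (rule that[OF M(1)])
    fix s t f assume "0 \<le> s" "s \<le> b" "0 \<le> t" "t \<le> b"
    then show "norm (S t f - S s f) \<le> M * norm (S \<bar>t - s\<bar> f - f)"
      using *[of s t f] *[of t s f] by (cases "s \<le> t") (auto simp: norm_minus_commute)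
  qed
qed

lemma continuous_on_orbit: "continuous_on {0..b} (\<lambda>t. S t f)"
proof -
  obtain M where M: "M \<ge> 1" "\<And>s t f. 0 \<le> s \<Longrightarrow> s \<le> b \<Longrightarrow> 0 \<le> t \<Longrightarrow> t \<le> b \<Longrightarrow>
     norm (S t f - S s f) \<le> M * norm (S \<bar>t - s\<bar> f - f)"
    using increment_bound[of b] by metis
  show ?thesis
    unfolding continuous_on_iff
  proof (intro ballI allI impI)
    fix s e :: real assume s: "s \<in> {0..b}" and e: "e > 0"
    have "eventually (\<lambda>t. dist (S t f) f < e / M) (at_right 0)"
      using e M(1) by (intro tendstoD[OF lim]) auto
    then obtain d where d: "d > 0" "\<And>t. 0 < t \<Longrightarrow> t < d \<Longrightarrow> dist (S t f) f < e / M"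
      unfolding eventually_at_right_field by blast
    have "dist (S t f) (S s f) < e" if t: "t \<in> {0..b}" "dist t s < d" for t
    proof -
      have "norm (S \<bar>t - s\<bar> f - f) < e / M"
        using d(2)[of "\<bar>t - s\<bar>"] t e M(1) by (cases "t = s") (auto simp: zero dist_norm)
      then have "M * norm (S \<bar>t - s\<bar> f - f) < e" using M(1) by (simp add: field_simps)
      then show ?thesis using M(2)[of s t f] s t by (simp add: dist_norm)
    qed
    then show "\<exists>d>0. \<forall>t\<in>{0..b}. dist t s < d \<longrightarrow> dist (S t f) (S s f) < e"
      using d(1) by blast
  qed
qed

text \<open>If the right difference quotient at \<open>0\<close> tends to \<open>0\<close>, the
  increment bound makes the difference quotients at every time do so from both sides. The orbit then
  has derivative zero on \<open>{0..b}\<close> and is constant.\<close>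

lemma generator_kernel_iff: "(f, 0) \<in> generator S \<longleftrightarrow> (\<forall>t\<ge>0. S t f = f)"
proof
  assume "(f, 0) \<in> generator S"
  then have lim0: "((\<lambda>t. (1 / t) *\<^sub>R (S t f - f)) \<longlongrightarrow> 0) (at_right 0)"
    by (simp add: generator_def)
  show "\<forall>t\<ge>0. S t f = f"
  proof (intro allI impI)
    fix b :: real assume b: "b \<ge> 0"
    obtain M where M: "M \<ge> 1" "\<And>s t f. 0 \<le> s \<Longrightarrow> s \<le> b \<Longrightarrow> 0 \<le> t \<Longrightarrow> t \<le> b \<Longrightarrow>
       norm (S t f - S s f) \<le> M * norm (S \<bar>t - s\<bar> f - f)"
      using increment_bound[of b] by metis
    have "((\<lambda>t. S t f) has_derivative (\<lambda>h. 0)) (at s within {0..b})" if s: "s \<in> {0..b}" for s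
      unfolding has_derivative_within_alt
    proof (intro conjI allI impI)
      show "bounded_linear (\<lambda>h::real. 0::'a)" by simp
      fix e :: real assume e: "e > 0"
      have "eventually (\<lambda>t. dist ((1 / t) *\<^sub>R (S t f - f)) 0 < e / M) (at_right 0)"
        using e M(1) by (intro tendstoD[OF lim0]) auto
      then obtain d where d: "d > 0"
          "\<And>t. 0 < t \<Longrightarrow> t < d \<Longrightarrow> dist ((1 / t) *\<^sub>R (S t f - f)) 0 < e / M"
        unfolding eventually_at_right_field by blast
      have "norm (S t f - S s f - 0) \<le> e * norm (t - s)"
        if t: "t \<in> {0..b}" "norm (t - s) < d" for t
      proof (cases "t = s")
        case False
        have "norm (S \<bar>t - s\<bar> f - f) / \<bar>t - s\<bar> < e / M"
          using d(2)[of "\<bar>t - s\<bar>"] t False by simp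
        then have "M * norm (S \<bar>t - s\<bar> f - f) < e * \<bar>t - s\<bar>"
          using M(1) False by (simp add: field_simps)
        then show ?thesis using M(2)[of s t f] s t by simp
      qed simp
      then show "\<exists>d>0. \<forall>t\<in>{0..b}. norm (t - s) < d \<longrightarrow> norm (S t f - S s f - 0) \<le> e * norm (t - s)"
        using d(1) by blast
    qed
    then have "S b f = S 0 f"
      using b by (intro has_derivative_zero_unique[of "{0..b}" "\<lambda>t. S t f" b 0]) auto
    then show "S b f = f" by (simp add: zero)
  qed
next
  assume "\<forall>t\<ge>0. S t f = f"
  then have "eventually (\<lambda>t. (1 / t) *\<^sub>R (S t f - f) = 0) (at_right 0)"
    by (intro eventually_mono[OF eventually_at_right_less]) simp
  then show "(f, 0) \<in> generator S"
    by (simp add: generator_def tendsto_eventually)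
qed

text \<open>Puts every \<open>S b f - f\<close> into the range of the generator, so that a
  functional vanishing on this range is invariant. The increment \<open>S h (G b) - G b\<close>
  equals \<open>(G (b + h) - G b) - (G h - G 0)\<close>, and the fundamental theorem of calculus
  gives the limits of both quotients.\<close>

lemma integral_in_generator:
  assumes b: "b > 0"
  shows "(integral {0..b} (\<lambda>s. S s f), S b f - f) \<in> generator S"
proof -
  define w where "w = (\<lambda>s. S s f)"
  define G where "G u = integral {0..u} w" for u
  have cont: "continuous_on {0..c} w" for c
    using continuous_on_orbit by (simp add: w_def)
  have int: "w integrable_on {0..c}" for c
    by (rule integrable_continuous_real[OF cont])
  have shift: "S h (G b) = G (b + h) - G h" if h: "h \<ge> 0" for h
  proof -
    have "S h (G b) = integral {0..b} (S h \<circ> w)"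
      unfolding G_def by (rule integral_linear[OF int linear[OF h], symmetric])
    also have "\<dots> = integral {0..b} (w \<circ> ((+) h))"
      using h by (intro integral_cong) (simp add: w_def add)
    also have "\<dots> = integral {h..b + h} w"
      using integral_shift_Icc_real[of 0 b w h] by simp
    also have "\<dots> = G (b + h) - G h"
      unfolding G_def
      using Henstock_Kurzweil_Integration.integral_combine[where a = 0 and c = h and b = "b + h" and f = w, OF h _ int] b
      by (metis add_diff_cancel_left' le_add_same_cancel2 less_imp_le)
    finally show ?thesis .
  qed
  have G0: "G 0 = 0" by (simp add: G_def)
  have deriv: "((\<lambda>h. (1 / h) *\<^sub>R (G (c + h) - G c)) \<longlongrightarrow> w c) (at_right 0)" if c: "c \<ge> 0" for c
  proof -
    \<comment> \<open>The interval extends beyond \<open>c\<close> by \<open>1\<close> so that it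
      contains \<open>c + h\<close> for all \<open>h < 1\<close>.\<close>
    have "(G has_vector_derivative w c) (at c within {0..c + 1})"
      unfolding G_def using c by (intro integral_has_vector_derivative cont) auto
    then have D: "\<exists>d>0. \<forall>y\<in>{0..c + 1}. norm (y - c) < d \<longrightarrow>
        norm (G y - G c - (y - c) *\<^sub>R w c) \<le> e * norm (y - c)" if "e > 0" for e
      using that unfolding has_vector_derivative_def has_derivative_within_alt by blast
    show ?thesis
    proof (rule tendstoI)
      fix e :: real assume e: "e > 0"
      obtain d where d: "d > 0" "\<And>y. y \<in> {0..c + 1} \<Longrightarrow> norm (y - c) < d \<Longrightarrow>
          norm (G y - G c - (y - c) *\<^sub>R w c) \<le> e / 2 * norm (y - c)"
        using D[of "e / 2"] e by auto
      have "dist ((1 / h) *\<^sub>R (G (c + h) - G c)) (w c) < e" if h: "0 < h" "h < min d 1" for h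
      proof -
        have "norm (G (c + h) - G c - h *\<^sub>R w c) \<le> e / 2 * h"
          using d(2)[of "c + h"] h c by simp
        moreover have "(1 / h) *\<^sub>R (G (c + h) - G c) - w c
            = (1 / h) *\<^sub>R (G (c + h) - G c - h *\<^sub>R w c)"
          using h by (simp add: algebra_simps)
        ultimately have "norm ((1 / h) *\<^sub>R (G (c + h) - G c) - w c) \<le> e / 2"
          using h by (simp only: norm_scaleR) (simp add: field_simps)
        then show ?thesis using e by (simp add: dist_norm)
      qed
      then show "eventually (\<lambda>h. dist ((1 / h) *\<^sub>R (G (c + h) - G c)) (w c) < e) (at_right 0)"
        unfolding eventually_at_right_field using d(1) by (intro exI[of _ "min d 1"]) auto
    qed
  qed
  have "((\<lambda>h. (1 / h) *\<^sub>R (G (b + h) - G b) - (1 / h) *\<^sub>R (G (0 + h) - G 0)) \<longlongrightarrow> w b - w 0) (at_right 0)"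
    using b by (intro tendsto_diff deriv) auto
  moreover have "eventually (\<lambda>h. (1 / h) *\<^sub>R (G (b + h) - G b) - (1 / h) *\<^sub>R (G (0 + h) - G 0)
      = (1 / h) *\<^sub>R (S h (G b) - G b)) (at_right 0)"
    by (rule eventually_mono[OF eventually_at_right_less])
      (simp add: shift G0 algebra_simps)
  ultimately have "((\<lambda>h. (1 / h) *\<^sub>R (S h (G b) - G b)) \<longlongrightarrow> w b - w 0) (at_right 0)"
    by (rule Lim_transform_eventually)
  then show ?thesis by (simp add: generator_def G_def w_def zero)
qed

end

section \<open>Rescaling, eigenvectors and dual eigenvectors\<close>

definition rescale :: "real \<Rightarrow> (real \<Rightarrow> 'a::complex_banach \<Rightarrow> 'a) \<Rightarrow> real \<Rightarrow> 'a \<Rightarrow> 'a" where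
  "rescale \<mu> T t f = exp (- \<mu> * t) *\<^sub>R T t f"

lemma rescale_rescale: "rescale \<mu> (rescale \<nu> T) = rescale (\<mu> + \<nu>) T"
  by (simp add: rescale_def fun_eq_iff algebra_simps flip: exp_add)

lemma rescale_zero: "rescale 0 T = T"
  by (simp add: rescale_def fun_eq_iff)

lemma C0_semigroup_rescale:
  assumes "C0_semigroup T"
  shows "C0_semigroup (rescale \<mu> T)"
proof -
  interpret c0_semigroup T by unfold_locales (rule assms)
  have "bounded_clinear (rescale \<mu> T t)" if "t \<ge> 0" for t
    unfolding bounded_clinear_def
  proof (intro conjI allI)
    have "bounded_linear (\<lambda>f. exp (- \<mu> * t) *\<^sub>R T t f)"
      by (rule bounded_linear_const_scaleR[OF linear[OF that]])
    then show "bounded_linear (rescale \<mu> T t)" by (simp add: rescale_def[abs_def])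
    show "rescale \<mu> T t (c *\<^sub>C f) = c *\<^sub>C rescale \<mu> T t f" for c f
      using clinear[OF that]
      by (simp add: rescale_def bounded_clinear_def scaleR_scaleC scaleC_scaleC mult.commute)
  qed
  moreover have "rescale \<mu> T 0 = id" by (simp add: rescale_def fun_eq_iff zero)
  moreover have "rescale \<mu> T (s + t) = rescale \<mu> T s \<circ> rescale \<mu> T t" if "s \<ge> 0" "t \<ge> 0" for s t
    using that
    by (simp add: rescale_def fun_eq_iff add linear_scale[OF bounded_linear.linear[OF linear]]
        algebra_simps flip: exp_add)
  moreover have "((\<lambda>t. rescale \<mu> T t f) \<longlongrightarrow> f) (at_right 0)" for f
  proof -
    have "((\<lambda>t. exp (- \<mu> * t)) \<longlongrightarrow> exp (- \<mu> * 0)) (at_right 0)" by (intro tendsto_intros)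
    from tendsto_scaleR[OF this lim[of f]] show ?thesis by (simp add: rescale_def)
  qed
  ultimately show ?thesis unfolding C0_semigroup_def by blast
qed

text \<open>The product rule at \<open>t = 0\<close>: the exponential factor contributes the term
  \<open>- \<mu> *\<^sub>R f\<close>.\<close>

lemma generator_rescaleI:
  assumes "(f, g) \<in> generator T"
  shows "(f, g - \<mu> *\<^sub>R f) \<in> generator (rescale \<mu> T)"
proof -
  have "((\<lambda>t. exp (- \<mu> * t)) has_real_derivative - \<mu>) (at 0)"
    by (auto intro!: derivative_eq_intros)
  then have "((\<lambda>t. (exp (- \<mu> * t) - 1) / t) \<longlongrightarrow> - \<mu>) (at 0)"
    by (simp add: DERIV_def)
  then have D: "((\<lambda>t. (exp (- \<mu> * t) - 1) / t) \<longlongrightarrow> - \<mu>) (at_right 0)"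
    by (rule tendsto_within_subset) simp
  have E: "((\<lambda>t. exp (- \<mu> * t)) \<longlongrightarrow> exp (- \<mu> * 0)) (at_right 0)" by (intro tendsto_intros)
  have "((\<lambda>t. exp (- \<mu> * t) *\<^sub>R ((1 / t) *\<^sub>R (T t f - f)) + ((exp (- \<mu> * t) - 1) / t) *\<^sub>R f)
      \<longlongrightarrow> exp (- \<mu> * 0) *\<^sub>R g + (- \<mu>) *\<^sub>R f) (at_right 0)"
    using assms by (intro tendsto_intros tendsto_add tendsto_scaleR D) (simp_all add: generator_def)
  moreover have "exp (- \<mu> * t) *\<^sub>R ((1 / t) *\<^sub>R (T t f - f)) + ((exp (- \<mu> * t) - 1) / t) *\<^sub>R f
      = (1 / t) *\<^sub>R (rescale \<mu> T t f - f)" for t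
    by (simp add: rescale_def algebra_simps diff_divide_distrib)
  ultimately show ?thesis by (simp add: generator_def)
qed

text \<open>Rescaling by \<open>- \<mu>\<close> undoes rescaling by \<open>\<mu>\<close>, so the
  implication just proved gives both directions.\<close>

lemma generator_rescale_iff:
  "(f, g) \<in> generator (rescale \<mu> T) \<longleftrightarrow> (f, g + \<mu> *\<^sub>R f) \<in> generator T"
  using generator_rescaleI[of f g "rescale \<mu> T" "- \<mu>"] generator_rescaleI[of f "g + \<mu> *\<^sub>R f" T \<mu>]
  by (auto simp: rescale_rescale rescale_zero)

lemma shifted_op_generator:
  "shifted_op (complex_of_real \<mu>) (generator T) = {(f, - g) | f g. (f, g) \<in> generator (rescale \<mu> T)}"
  unfolding shifted_op_def generator_rescale_iff
proof (intro Collect_cong iffI; elim exE conjE)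
  fix p f g assume "p = (f, complex_of_real \<mu> *\<^sub>C f - g)" "(f, g) \<in> generator T"
  then show "\<exists>f g. p = (f, - g) \<and> (f, g + \<mu> *\<^sub>R f) \<in> generator T"
    by (intro exI[of _ f] exI[of _ "g - \<mu> *\<^sub>R f"]) (simp add: scaleR_scaleC)
next
  fix p f g assume "p = (f, - g)" "(f, g + \<mu> *\<^sub>R f) \<in> generator T"
  then show "\<exists>f g. p = (f, complex_of_real \<mu> *\<^sub>C f - g) \<and> (f, g) \<in> generator T"
    by (intro exI[of _ f] exI[of _ "g + \<mu> *\<^sub>R f"]) (simp add: scaleR_scaleC)
qed

lemma eigenspace_generator:
  assumes "C0_semigroup T"
  shows "f \<in> op_ker (shifted_op (complex_of_real \<mu>) (generator T)) \<longleftrightarrow> (\<forall>t\<ge>0. rescale \<mu> T t f = f)"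
proof -
  interpret c0_semigroup "rescale \<mu> T"
    by unfold_locales (rule C0_semigroup_rescale[OF assms])
  show ?thesis
    unfolding op_ker_def shifted_op_generator using generator_kernel_iff[of f] by simp
qed

text \<open>On the domain of \<open>A\<close> the functional sends \<open>A f\<close> to
  \<open>\<mu>\<close> times its value at \<open>f\<close>. This serves twice: for invariance under
  the semigroup and for excluding Jordan chains.\<close>

lemma dual_eigenvector_annihilates_range:
  assumes "\<phi> \<in> op_ker (shifted_op \<mu> (dual_operator A))" "(f, h) \<in> shifted_op \<mu> A"
  shows "blinfun_apply \<phi> h = 0"
proof -
  obtain \<theta> where \<theta>: "(\<phi>, \<theta>) \<in> dual_operator A" "\<mu> *\<^sub>C \<phi> - \<theta> = 0"
    using assms(1) by (auto simp: op_ker_def shifted_op_def)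
  then have \<theta>_eq: "\<theta> = \<mu> *\<^sub>C \<phi>" by simp
  obtain g where g: "(f, g) \<in> A" "h = \<mu> *\<^sub>C f - g"
    using assms(2) by (auto simp: shifted_op_def)
  have "blinfun_apply \<phi> g = blinfun_apply \<theta> f"
    using \<theta>(1) g(1) by (auto simp: dual_operator_def)
  also have "\<dots> = \<mu> * blinfun_apply \<phi> f"
    unfolding \<theta>_eq by (simp add: scaleC_blinfun.rep_eq scaleC_complex_def)
  also have "\<dots> = blinfun_apply \<phi> (\<mu> *\<^sub>C f)"
    using \<theta>(1) by (simp add: dual_operator_def dual_space_def bounded_clinear_def scaleC_complex_def)
  finally show ?thesis by (simp add: g(2) blinfun.diff_right)
qed

text \<open>Up to sign, \<open>rescale \<mu> T t f - f\<close> lies in the range of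
  \<open>\<mu> - A\<close>, with the orbit integral as preimage.\<close>

lemma dual_eigenvector_invariant:
  assumes "C0_semigroup T" "\<phi> \<in> op_ker (shifted_op (complex_of_real \<mu>) (dual_operator (generator T)))"
    and "t \<ge> 0"
  shows "blinfun_apply \<phi> (rescale \<mu> T t f) = blinfun_apply \<phi> f"
proof (cases "t = 0")
  case True
  then show ?thesis using assms(1) by (simp add: rescale_def C0_semigroup_def)
next
  case False
  interpret c0_semigroup "rescale \<mu> T"
    by unfold_locales (rule C0_semigroup_rescale[OF assms(1)])
  have "(integral {0..t} (\<lambda>s. rescale \<mu> T s f), - (rescale \<mu> T t f - f))
      \<in> shifted_op (complex_of_real \<mu>) (generator T)"
    unfolding shifted_op_generator using integral_in_generator[of t f] False assms(3) by fastforce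
  from dual_eigenvector_annihilates_range[OF assms(2) this] show ?thesis
    by (simp add: blinfun.minus_right blinfun.diff_right)
qed

section \<open>Ideals in Banach lattices\<close>

lemma norm_mono_nonneg:
  fixes x y :: "'a::banach_lattice"
  shows "0 \<le> x \<Longrightarrow> x \<le> y \<Longrightarrow> norm x \<le> norm y"
  by (rule norm_mono_abs) auto

lemma pprt_add_le:
  fixes x y :: "'a::lattice_ab_group_add"
  shows "pprt (x + y) \<le> pprt x + pprt y"
  by (simp add: pprt_def add_increasing add_increasing2 add_mono)

text \<open>Monotonicity of scaling gives one inequality; applying it to \<open>inverse c\<close>
  and \<open>c *\<^sub>R x\<close> gives the other.\<close>

lemma pprt_scaleR:
  fixes x :: "'a::banach_lattice"
  assumes "0 \<le> c"
  shows "pprt (c *\<^sub>R x) = c *\<^sub>R pprt x"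
proof (cases "c = 0")
  case False
  with assms have c: "c > 0" by simp
  have le: "pprt (c *\<^sub>R x) \<le> c *\<^sub>R pprt x" if "c \<ge> 0" for c and x :: 'a
    using that by (simp add: pprt_def scaleR_left_mono) (metis scaleR_left_mono sup_ge2 scaleR_zero_right)
  have "c *\<^sub>R pprt x = c *\<^sub>R pprt (inverse c *\<^sub>R c *\<^sub>R x)" using c by simp
  also have "\<dots> \<le> c *\<^sub>R inverse c *\<^sub>R pprt (c *\<^sub>R x)"
    using c by (intro scaleR_left_mono le) auto
  finally have "c *\<^sub>R pprt x \<le> pprt (c *\<^sub>R x)" using c by simp
  with le assms show ?thesis by (simp add: antisym)
qed simp

lemma abs_scaleR_banach_lattice:
  fixes x :: "'a::banach_lattice"
  shows "\<bar>c *\<^sub>R x\<bar> = \<bar>c\<bar> *\<^sub>R \<bar>x\<bar>"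
proof -
  have pos: "\<bar>d *\<^sub>R x\<bar> = d *\<^sub>R \<bar>x\<bar>" if "d \<ge> 0" for d
    using pprt_scaleR[OF that, of x] pprt_scaleR[OF that, of "- x"]
    by (simp add: abs_prts pprt_neg algebra_simps)
  show ?thesis
  proof (cases "c \<ge> 0")
    case False
    have "\<bar>c *\<^sub>R x\<bar> = \<bar>(- c) *\<^sub>R x\<bar>" by (simp add: abs_minus_cancel)
    also have "\<dots> = (- c) *\<^sub>R \<bar>x\<bar>" using False by (intro pos) simp
    finally show ?thesis using False by simp
  qed (simp add: pos)
qed

lemma closed_order_interval_banach_lattice:
  fixes a b :: "'a::banach_lattice"
  shows "closed {x. a \<le> x \<and> x \<le> b}"
  unfolding closed_sequential_limits
  by (auto intro: le_limit_banach_lattice[OF tendsto_const] le_limit_banach_lattice[OF _ tendsto_const])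

lemma convex_order_interval:
  fixes a b :: "'a::ordered_real_vector"
  shows "convex {x. a \<le> x \<and> x \<le> b}"
proof (rule convexI)
  fix x y :: 'a and u v :: real
  assume xy: "x \<in> {x. a \<le> x \<and> x \<le> b}" "y \<in> {x. a \<le> x \<and> x \<le> b}"
    and uv: "0 \<le> u" "0 \<le> v" "u + v = 1"
  have "u *\<^sub>R a + v *\<^sub>R a \<le> u *\<^sub>R x + v *\<^sub>R y" "u *\<^sub>R x + v *\<^sub>R y \<le> u *\<^sub>R b + v *\<^sub>R b"
    using xy uv by (auto intro!: add_mono scaleR_left_mono)
  then show "u *\<^sub>R x + v *\<^sub>R y \<in> {x. a \<le> x \<and> x \<le> b}"
    using uv by (simp flip: scaleR_add_left)
qed

section \<open>Closed principal ideals\<close>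

definition real_lattice_ideal :: "'a::banach_lattice set \<Rightarrow> bool" where
  "real_lattice_ideal J \<longleftrightarrow> subspace J \<and> (\<forall>x y. y \<in> J \<longrightarrow> \<bar>x\<bar> \<le> \<bar>y\<bar> \<longrightarrow> x \<in> J)"

lemma real_lattice_idealI:
  fixes J :: "'a::banach_lattice set"
  assumes "0 \<in> J" "\<And>x y. x \<in> J \<Longrightarrow> y \<in> J \<Longrightarrow> x + y \<in> J"
    "\<And>c x. x \<in> J \<Longrightarrow> c *\<^sub>R x \<in> J" "\<And>x y. y \<in> J \<Longrightarrow> \<bar>x\<bar> \<le> \<bar>y\<bar> \<Longrightarrow> x \<in> J"
  shows "real_lattice_ideal J"
  using assms unfolding real_lattice_ideal_def subspace_def by blast

text \<open>The closure of the principal ideal generated by \<open>f \<ge> 0\<close>, described so that solidity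
  and closedness need no continuity of the lattice operations.\<close>

definition principal_closure :: "'a::banach_lattice \<Rightarrow> 'a set" where
  "principal_closure f = {x. \<forall>e>0. \<exists>n::nat. norm (pprt (\<bar>x\<bar> - real n *\<^sub>R f)) < e}"

text \<open>The excess of \<open>\<bar>x\<bar>\<close> over a multiple of \<open>f\<close> is
  measured by a positive part, which is monotone, subadditive and positively homogeneous; the
  multiples of \<open>f\<close> add and scale accordingly.\<close>

lemma principal_closure_ideal:
  fixes f :: "'a::banach_lattice"
  assumes f: "0 \<le> f"
  shows "real_lattice_ideal (principal_closure f)"
proof (rule real_lattice_idealI)
  show "0 \<in> principal_closure f" by (auto simp: principal_closure_def intro: exI[of _ 0])
next
  fix x y assume xy: "x \<in> principal_closure f" "y \<in> principal_closure f"
  show "x + y \<in> principal_closure f"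
    unfolding principal_closure_def
  proof (intro CollectI allI impI)
    fix e :: real assume "e > 0"
    then have "e / 2 > 0" by simp
    with xy obtain n m where nm: "norm (pprt (\<bar>x\<bar> - real n *\<^sub>R f)) < e / 2"
        "norm (pprt (\<bar>y\<bar> - real m *\<^sub>R f)) < e / 2"
      unfolding principal_closure_def by blast
    have "\<bar>x + y\<bar> - real (n + m) *\<^sub>R f \<le> (\<bar>x\<bar> - real n *\<^sub>R f) + (\<bar>y\<bar> - real m *\<^sub>R f)"
      using abs_triangle_ineq[of x y] by (simp add: algebra_simps)
    then have "pprt (\<bar>x + y\<bar> - real (n + m) *\<^sub>R f)
        \<le> pprt (\<bar>x\<bar> - real n *\<^sub>R f) + pprt (\<bar>y\<bar> - real m *\<^sub>R f)"
      by (meson order_trans pprt_add_le pprt_mono)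
    then have "norm (pprt (\<bar>x + y\<bar> - real (n + m) *\<^sub>R f))
        \<le> norm (pprt (\<bar>x\<bar> - real n *\<^sub>R f) + pprt (\<bar>y\<bar> - real m *\<^sub>R f))"
      by (intro norm_mono_nonneg) auto
    also have "\<dots> < e" by (rule norm_triangle_lt) (use nm in linarith)
    finally show "\<exists>n. norm (pprt (\<bar>x + y\<bar> - real n *\<^sub>R f)) < e" by blast
  qed
next
  fix c :: real and x assume x: "x \<in> principal_closure f"
  show "c *\<^sub>R x \<in> principal_closure f"
    unfolding principal_closure_def
  proof (intro CollectI allI impI)
    fix e :: real assume e: "e > 0"
    \<comment> \<open>The \<open>+ 1\<close> covers \<open>c = 0\<close> and makes the final
      inequality strict; \<open>m\<close> below rounds \<open>\<bar>c\<bar> * n\<close> up to a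
      natural number.\<close>
    have "e / (\<bar>c\<bar> + 1) > 0" using e by (intro divide_pos_pos) auto
    then obtain n where n: "norm (pprt (\<bar>x\<bar> - real n *\<^sub>R f)) < e / (\<bar>c\<bar> + 1)"
      using x unfolding principal_closure_def by blast
    obtain m :: nat where m: "real m \<ge> \<bar>c\<bar> * real n" using real_arch_simple by blast
    have "\<bar>c *\<^sub>R x\<bar> - real m *\<^sub>R f \<le> \<bar>c\<bar> *\<^sub>R (\<bar>x\<bar> - real n *\<^sub>R f)"
      using scaleR_right_mono[OF m f] by (simp add: abs_scaleR_banach_lattice algebra_simps)
    then have "pprt (\<bar>c *\<^sub>R x\<bar> - real m *\<^sub>R f) \<le> \<bar>c\<bar> *\<^sub>R pprt (\<bar>x\<bar> - real n *\<^sub>R f)"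
      by (metis abs_ge_zero pprt_mono pprt_scaleR)
    then have "norm (pprt (\<bar>c *\<^sub>R x\<bar> - real m *\<^sub>R f)) \<le> norm (\<bar>c\<bar> *\<^sub>R pprt (\<bar>x\<bar> - real n *\<^sub>R f))"
      by (intro norm_mono_nonneg) auto
    also have "\<dots> = \<bar>c\<bar> * norm (pprt (\<bar>x\<bar> - real n *\<^sub>R f))" by simp
    also have "\<dots> \<le> \<bar>c\<bar> * (e / (\<bar>c\<bar> + 1))" using n by (intro mult_left_mono) auto
    also have "\<dots> < e" using e by (simp add: field_simps)
    finally show "\<exists>n. norm (pprt (\<bar>c *\<^sub>R x\<bar> - real n *\<^sub>R f)) < e" by blast
  qed
next
  fix x y assume y: "y \<in> principal_closure f" and le: "\<bar>x\<bar> \<le> \<bar>y\<bar>"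
  have "norm (pprt (\<bar>x\<bar> - real n *\<^sub>R f)) \<le> norm (pprt (\<bar>y\<bar> - real n *\<^sub>R f))" for n :: nat
    using le by (intro norm_mono_nonneg pprt_mono diff_right_mono) auto
  then show "x \<in> principal_closure f"
    using y unfolding principal_closure_def by (blast intro: le_less_trans)
qed

text \<open>Replacing \<open>y\<close> by \<open>x\<close> increases the excess over
  \<open>n\<close> times \<open>f\<close> by at most \<open>\<bar>y - x\<bar>\<close>, whose norm is
  the distance.\<close>

lemma closed_principal_closure:
  fixes f :: "'a::banach_lattice"
  shows "closed (principal_closure f)"
  unfolding closure_subset_eq[symmetric]
proof
  fix x assume "x \<in> closure (principal_closure f)"
  then have app: "\<forall>e>0. \<exists>y\<in>principal_closure f. dist y x < e"
    by (simp add: closure_approachable)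
  show "x \<in> principal_closure f"
    unfolding principal_closure_def
  proof (intro CollectI allI impI)
    fix e :: real assume "e > 0"
    then have e: "e / 2 > 0" by simp
    with app obtain y where y: "y \<in> principal_closure f" "dist y x < e / 2" by blast
    with e obtain n where n: "norm (pprt (\<bar>y\<bar> - real n *\<^sub>R f)) < e / 2"
      unfolding principal_closure_def by blast
    have "\<bar>x\<bar> - real n *\<^sub>R f \<le> \<bar>y - x\<bar> + (\<bar>y\<bar> - real n *\<^sub>R f)"
      using abs_triangle_ineq[of "x - y" y] by (simp add: abs_minus_commute)
    then have "pprt (\<bar>x\<bar> - real n *\<^sub>R f) \<le> pprt \<bar>y - x\<bar> + pprt (\<bar>y\<bar> - real n *\<^sub>R f)"
      by (meson order_trans pprt_add_le pprt_mono)
    then have "norm (pprt (\<bar>x\<bar> - real n *\<^sub>R f)) \<le> norm (\<bar>y - x\<bar> + pprt (\<bar>y\<bar> - real n *\<^sub>R f))"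
      by (intro norm_mono_nonneg) auto
    also have "\<dots> < e"
      using n y(2) norm_triangle_ineq[of "\<bar>y - x\<bar>" "pprt (\<bar>y\<bar> - real n *\<^sub>R f)"]
      by (simp add: norm_abs_banach_lattice dist_norm)
    finally show "\<exists>n. norm (pprt (\<bar>x\<bar> - real n *\<^sub>R f)) < e" by blast
  qed
qed

text \<open>Clamping \<open>x\<close> to the order interval between \<open>- n\<close> and
  \<open>n\<close> times \<open>f\<close> changes it by at most the excess of
  \<open>\<bar>x\<bar>\<close> over \<open>n\<close> times \<open>f\<close>. Thus the vectors
  dominated by multiples of \<open>f\<close> are dense in
  \<open>principal_closure f\<close>.\<close>

lemma principal_closure_approx:
  fixes f :: "'a::banach_lattice"
  assumes f: "0 \<le> f" and x: "x \<in> principal_closure f" and e: "e > 0"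
  obtains y and n :: nat where "\<bar>y\<bar> \<le> real n *\<^sub>R f" "norm (x - y) < e"
proof -
  obtain n where n: "norm (pprt (\<bar>x\<bar> - real n *\<^sub>R f)) < e"
    using x e unfolding principal_closure_def by blast
  define y where "y = inf (real n *\<^sub>R f) (sup x (- (real n *\<^sub>R f)))"
  have nf: "0 \<le> real n *\<^sub>R f" using f by (simp add: scaleR_nonneg_nonneg)
  then have "- (real n *\<^sub>R f) \<le> real n *\<^sub>R f" by (simp add: minus_le_self_iff)
  then have y: "\<bar>y\<bar> \<le> real n *\<^sub>R f"
    by (intro abs_leI) (auto simp: y_def minus_le_iff)
  let ?p = "pprt (\<bar>x\<bar> - real n *\<^sub>R f)"
  have p: "\<bar>x\<bar> - real n *\<^sub>R f \<le> ?p" "0 \<le> ?p" by (auto simp: pprt_def)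
  have "x - ?p \<le> y"
  proof -
    have "x - ?p \<le> real n *\<^sub>R f" using p(1) abs_ge_self[of x]
      by (simp add: algebra_simps)
    moreover have "x - ?p \<le> x" using p(2) by simp
    ultimately show ?thesis by (auto simp: y_def intro: le_supI1)
  qed
  moreover have "y \<le> x + ?p"
  proof -
    have "- x \<le> real n *\<^sub>R f + ?p"
      using p(1) by (intro order_trans[OF abs_ge_minus_self[of x]]) (simp add: diff_le_eq add.commute)
    then have "- (x + ?p) \<le> real n *\<^sub>R f" by (simp add: diff_le_eq)
    then have "- (real n *\<^sub>R f) \<le> x + ?p" by (simp only: minus_le_iff)
    moreover have "x \<le> x + ?p" using p(2) by simp
    ultimately show ?thesis by (auto simp: y_def intro: le_infI2)
  qed
  ultimately have "\<bar>x - y\<bar> \<le> \<bar>?p\<bar>"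
    by (auto simp: algebra_simps intro!: abs_leI)
  then have "norm (x - y) \<le> norm ?p" by (rule norm_mono_abs)
  with n y show thesis by (intro that[of y n]) auto
qed

text \<open>A vector disjoint from \<open>f\<close> is disjoint from all multiples of
  \<open>f\<close>, so subtracting a multiple and taking the positive part returns \<open>x\<close>
  unchanged. Approximability then bounds \<open>norm x\<close> by every positive number.\<close>

lemma disjoint_principal_closure:
  fixes f x :: "'a::banach_lattice"
  assumes "0 \<le> f" "0 \<le> x" "inf x f = 0" "x \<in> principal_closure f"
  shows "x = 0"
proof -
  have inf0: "inf x (real n *\<^sub>R f) = 0" for n
  proof (induction n)
    case (Suc n)
    let ?m = "inf x (real (Suc n) *\<^sub>R f)"
    have m: "0 \<le> ?m" using assms by (simp add: scaleR_nonneg_nonneg)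
    \<comment> \<open>By induction hypothesis the right-hand side is \<open>0\<close>, so
      \<open>?m\<close> lies below \<open>f\<close> as well as below \<open>x\<close>.\<close>
    have "?m - f \<le> inf x (real n *\<^sub>R f)"
    proof (rule inf_greatest)
      have "?m \<le> x + f" using assms(1) by (meson inf_le1 add_increasing2 order_trans order_refl)
      then show "?m - f \<le> x" by (simp only: diff_le_eq)
      have "?m \<le> real n *\<^sub>R f + f" by (rule order_trans[OF inf_le2]) (simp add: algebra_simps)
      then show "?m - f \<le> real n *\<^sub>R f" by (simp only: diff_le_eq)
    qed
    then have "?m \<le> f" using Suc.IH by simp
    then have "?m \<le> inf x f" by simp
    then show ?case using assms(3) m by (simp add: antisym)
  qed (use assms in \<open>simp add: inf_absorb2\<close>)
  have "pprt (\<bar>x\<bar> - real n *\<^sub>R f) = x" for n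
  proof -
    have "pprt (\<bar>x\<bar> - real n *\<^sub>R f) = x - inf x (real n *\<^sub>R f)"
      using assms(2) by (simp add: pprt_def add_sup_distrib_left sup_commute)
    then show ?thesis using inf0 by simp
  qed
  then have "norm x < e" if "e > 0" for e
    using assms(4) that by (auto simp: principal_closure_def)
  then show ?thesis by (metis less_irrefl zero_less_norm_iff)
qed

section \<open>Irreducible eventually positive semigroups on real Banach lattices\<close>

text \<open>Models the real part of the rescaled semigroup, for which the eigenvalue is
  \<open>0\<close>; \<open>\<psi>\<close> stands for the dual eigenvector restricted to real
  vectors.\<close>

locale eventually_positive_irreducible =
  fixes R :: "real \<Rightarrow> 'a::banach_lattice \<Rightarrow> 'a" and \<psi> :: "'a \<Rightarrow> real"
  assumes lin: "\<And>t. t \<ge> 0 \<Longrightarrow> bounded_linear (R t)"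
    and semigroup: "\<And>s t x. s \<ge> 0 \<Longrightarrow> t \<ge> 0 \<Longrightarrow> R (s + t) x = R s (R t x)"
    and ev_nonneg: "\<And>x. 0 \<le> x \<Longrightarrow> \<forall>\<^sub>F t in at_top. 0 \<le> R t x"
    and irreducible: "\<And>J. closed J \<Longrightarrow> real_lattice_ideal J \<Longrightarrow>
      \<exists>t0\<ge>0. \<forall>t\<ge>t0. R t ` J \<subseteq> J \<Longrightarrow> J = {0} \<or> J = UNIV"
    and psi_linear: "bounded_linear \<psi>"
    and psi_nonneg: "\<And>x. 0 \<le> x \<Longrightarrow> 0 \<le> \<psi> x"
    and psi_nonzero: "\<exists>x. \<psi> x \<noteq> 0"
    and psi_invariant: "\<And>t x. t \<ge> 0 \<Longrightarrow> \<psi> (R t x) = \<psi> x"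
begin

sublocale psi: bounded_linear \<psi> by (rule psi_linear)

lemma psi_mono: "x \<le> y \<Longrightarrow> \<psi> x \<le> \<psi> y"
  using psi_nonneg[of "y - x"] by (simp add: psi.diff)

lemma ev_into_subspace:
  assumes "closed C" "convex C" "closed J" "subspace J"
    and "\<And>x. x \<in> C \<Longrightarrow> \<forall>\<^sub>F t in at_top. R t x \<in> J"
  shows "\<exists>t0\<ge>0. \<forall>t\<ge>t0. R t ` C \<subseteq> J"
proof (rule Baire_eventually_into_subspace[OF lin assms(1-4)])
  fix x assume "x \<in> C"
  then have "\<forall>\<^sub>F t in at_top. R t x \<in> J" by (rule assms(5))
  then obtain t0 where "\<forall>t\<ge>t0. R t x \<in> J" by (auto simp: eventually_at_top_linorder)
  then show "\<exists>t0\<ge>0. \<forall>t\<ge>t0. R t x \<in> J" by (intro exI[of _ "max t0 0"]) auto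
qed

text \<open>Both \<open>\<bar>x\<bar> - x\<close> and \<open>\<bar>x\<bar> + x\<close> are positive,
  hence have eventually positive images. The time still depends on \<open>x\<close>.\<close>

lemma ev_abs_le: "\<forall>\<^sub>F t in at_top. \<bar>R t x\<bar> \<le> R t \<bar>x\<bar>"
proof -
  have nonneg: "0 \<le> \<bar>x\<bar> - x" "0 \<le> \<bar>x\<bar> + x"
    using abs_ge_self[of x] abs_ge_minus_self[of x] diff_le_eq[of 0 x "\<bar>x\<bar>"]
    by simp_all
  show ?thesis
    using ev_nonneg[OF nonneg(1)] ev_nonneg[OF nonneg(2)] eventually_ge_at_top[of 0]
  proof eventually_elim
    case (elim t)
    interpret bounded_linear "R t" using lin elim by simp
    show ?case
      using elim diff_le_eq[of 0 "R t x" "R t \<bar>x\<bar>"] by (intro abs_leI) (auto simp: diff add)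
  qed
qed

text \<open>Eventually \<open>\<psi> \<bar>R t x\<bar> \<le> \<psi> (R t \<bar>x\<bar>) = \<psi>
  \<bar>x\<bar>\<close>, so each vector of the null ideal \<open>J\<close> eventually has its orbit
  in \<open>J\<close>. A common time makes irreducibility applicable, and \<open>J\<close> is not
  everything because \<open>\<psi>\<close> is non-zero.\<close>

lemma psi_strict:
  assumes "0 \<le> x" "\<psi> x = 0"
  shows "x = 0"
proof -
  define J where "J = {x. \<psi> \<bar>x\<bar> = 0}"
  have J_I: "x \<in> J" if "\<psi> \<bar>x\<bar> \<le> 0" for x
    using psi_nonneg[of "\<bar>x\<bar>"] that by (simp add: J_def)
  have ideal: "real_lattice_ideal J"
  proof (rule real_lattice_idealI)
    show "0 \<in> J" by (simp add: J_def psi.zero)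
    show "x + y \<in> J" if "x \<in> J" "y \<in> J" for x y
      using psi_mono[OF abs_triangle_ineq[of x y]] that by (intro J_I) (auto simp: J_def psi.add)
    show "c *\<^sub>R x \<in> J" if "x \<in> J" for c x
      using that by (simp add: J_def abs_scaleR_banach_lattice psi.scaleR)
    show "x \<in> J" if "y \<in> J" "\<bar>x\<bar> \<le> \<bar>y\<bar>" for x y
      using psi_mono[OF that(2)] that(1) by (intro J_I) (simp add: J_def)
  qed
  have cl: "closed J"
    unfolding closure_subset_eq[symmetric]
  proof
    fix x assume x: "x \<in> closure J"
    obtain K where K: "K > 0" "\<And>x. norm (\<psi> x) \<le> norm x * K" using psi.pos_bounded by blast
    show "x \<in> J"
    proof (rule J_I, rule field_le_epsilon)
      fix e :: real assume "e > 0"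
      then obtain y where y: "y \<in> J" "dist y x < e / K"
        using x K(1) unfolding closure_approachable by (meson divide_pos_pos)
      have "\<psi> \<bar>x\<bar> \<le> \<psi> (\<bar>x - y\<bar> + \<bar>y\<bar>)"
        using abs_triangle_ineq[of "x - y" y] by (intro psi_mono) simp
      also have "\<dots> = \<psi> \<bar>x - y\<bar>" using y(1) by (simp add: psi.add J_def)
      also have "\<dots> \<le> norm (x - y) * K"
        using K(2)[of "\<bar>x - y\<bar>"] by (simp add: norm_abs_banach_lattice)
      also have "\<dots> \<le> e" using y(2) K(1) by (simp add: dist_norm norm_minus_commute field_simps)
      finally show "\<psi> \<bar>x\<bar> \<le> 0 + e" by simp
    qed
  qed
  have sub: "subspace J" using ideal by (simp add: real_lattice_ideal_def)
  have "\<forall>\<^sub>F t in at_top. R t x \<in> J" if x: "x \<in> J" for x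
    using ev_abs_le[of x] eventually_ge_at_top[of 0]
  proof eventually_elim
    case (elim t)
    then show ?case
      using psi_mono[OF elim(1)] x by (intro J_I) (simp add: psi_invariant J_def)
  qed
  \<comment> \<open>The Baire argument is used with \<open>J\<close> as both source and
    target.\<close>
  then have "J = {0} \<or> J = UNIV"
    using cl ideal sub by (intro irreducible ev_into_subspace subspace_imp_convex) auto
  moreover have "J \<noteq> UNIV"
  proof
    assume "J = UNIV"
    obtain y where y: "\<psi> y \<noteq> 0" using psi_nonzero by blast
    have "\<psi> y \<le> \<psi> \<bar>y\<bar>" "\<psi> (- y) \<le> \<psi> \<bar>y\<bar>" by (auto intro!: psi_mono simp: abs_ge_minus_self abs_ge_self)
    moreover have "\<psi> \<bar>y\<bar> = 0" using \<open>J = UNIV\<close> by (auto simp: J_def)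
    ultimately show False using y by (simp add: psi.neg)
  qed
  ultimately have "J = {0}" by simp
  moreover have "x \<in> J" using assms by (simp add: J_def)
  ultimately show ?thesis by simp
qed

section \<open>The real fixed space\<close>

definition fixed :: "'a set" where
  "fixed = {x. \<forall>t\<ge>0. R t x = x}"

lemma fixedD: "x \<in> fixed \<Longrightarrow> t \<ge> 0 \<Longrightarrow> R t x = x"
  by (simp add: fixed_def)

lemma subspace_fixed: "subspace fixed"
  unfolding subspace_def fixed_def
  by (auto simp: linear_add[OF bounded_linear.linear[OF lin]]
      linear_scale[OF bounded_linear.linear[OF lin]] linear_0[OF bounded_linear.linear[OF lin]])

text \<open>For late \<open>t\<close>,
  \<open>\<bar>x\<bar> = \<bar>R t x\<bar> \<le> R t \<bar>x\<bar>\<close>. The difference is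
  positive and annihilated by the strictly positive \<open>\<psi>\<close>, hence zero.\<close>

lemma abs_in_fixed:
  assumes x: "x \<in> fixed"
  shows "\<bar>x\<bar> \<in> fixed"
proof -
  have "\<forall>\<^sub>F t in at_top. R t \<bar>x\<bar> = \<bar>x\<bar>"
    using ev_abs_le[of x] eventually_ge_at_top[of 0]
  proof eventually_elim
    case (elim t)
    have "R t \<bar>x\<bar> - \<bar>x\<bar> = 0"
      using elim x by (intro psi_strict) (simp_all add: psi.diff psi_invariant fixedD)
    then show ?case by simp
  qed
  then obtain t0 where t0: "\<And>t. t \<ge> t0 \<Longrightarrow> R t \<bar>x\<bar> = \<bar>x\<bar>"
    by (auto simp: eventually_at_top_linorder)
  show ?thesis
    unfolding fixed_def
  proof (intro CollectI allI impI)
    fix s :: real assume s: "s \<ge> 0"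
    define t where "t = max t0 0"
    \<comment> \<open>Being fixed at all late times spreads to every \<open>s\<close>, since both
      \<open>t\<close> and \<open>s + t\<close> are late.\<close>
    have "R s \<bar>x\<bar> = R s (R t \<bar>x\<bar>)" by (simp add: t0 t_def)
    also have "\<dots> = R (s + t) \<bar>x\<bar>" using s by (simp add: semigroup t_def)
    also have "\<dots> = \<bar>x\<bar>" using s by (intro t0) (simp add: t_def)
    finally show "R s \<bar>x\<bar> = \<bar>x\<bar>" .
  qed
qed

text \<open>If \<open>\<bar>x\<bar> \<le> f\<close> then eventually
  \<open>\<bar>R t x\<bar> \<le> R t \<bar>x\<bar> \<le> f\<close>. Baire on the order interval
  makes the time uniform; scaling and continuity of each \<open>R t\<close> carry invariance to the
  whole closed ideal.\<close>

lemma fixed_quasi_interior: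
  assumes f: "f \<in> fixed" "0 \<le> f" "f \<noteq> 0"
  shows "principal_closure f = UNIV"
proof -
  let ?J = "principal_closure f" and ?C = "{x. - f \<le> x \<and> x \<le> f}"
  have ideal: "real_lattice_ideal ?J" by (rule principal_closure_ideal[OF f(2)])
  then have sub: "subspace ?J" and solid: "\<And>x y. y \<in> ?J \<Longrightarrow> \<bar>x\<bar> \<le> \<bar>y\<bar> \<Longrightarrow> x \<in> ?J"
    by (auto simp: real_lattice_ideal_def)
  have fJ: "f \<in> ?J"
    using f(2) by (auto simp: principal_closure_def intro!: exI[of _ 1])
  \<comment> \<open>The target is the ideal and not the interval, because the Baire argument needs a
    subspace there.\<close>
  have "\<exists>t0\<ge>0. \<forall>t\<ge>t0. R t ` ?C \<subseteq> ?J"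
  proof (rule ev_into_subspace[OF closed_order_interval_banach_lattice convex_order_interval
        closed_principal_closure sub])
    fix x assume "x \<in> ?C"
    then have "\<bar>x\<bar> \<le> f" by (auto intro: abs_leI simp: minus_le_iff)
    then have "\<forall>\<^sub>F t in at_top. 0 \<le> R t (f - \<bar>x\<bar>)" by (intro ev_nonneg) simp
    then show "\<forall>\<^sub>F t in at_top. R t x \<in> ?J"
      using ev_abs_le[of x] eventually_ge_at_top[of 0]
    proof eventually_elim
      case (elim t)
      interpret bounded_linear "R t" using lin elim by simp
      have "\<bar>R t x\<bar> \<le> \<bar>f\<bar>" using elim f by (simp add: diff fixedD)
      with fJ show ?case by (rule solid)
    qed
  qed
  then obtain t0 where t0: "t0 \<ge> 0" "\<And>t x. t \<ge> t0 \<Longrightarrow> x \<in> ?C \<Longrightarrow> R t x \<in> ?J" by blast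
  have "R t x \<in> ?J" if t: "t \<ge> t0" and x: "x \<in> ?J" for t x
  proof -
    interpret bounded_linear "R t" using lin t t0(1) by simp
    obtain K where K: "K > 0" "\<And>x. norm (R t x) \<le> norm x * K" using pos_bounded by blast
    have "R t x \<in> closure ?J"
      unfolding closure_approachable
    proof (intro allI impI)
      fix e :: real assume "e > 0"
      then have "e / K > 0" using K(1) by simp
      then obtain y n where y: "\<bar>y\<bar> \<le> real n *\<^sub>R f" "norm (x - y) < e / K"
        using principal_closure_approx[OF f(2) x] by metis
      have "R t y \<in> ?J"
      proof (cases "n = 0")
        case True
        then have "y = 0" using y(1) by simp
        then show ?thesis using subspace_0[OF sub] by (simp add: zero)
      next
        case False
        have "\<bar>(1 / real n) *\<^sub>R y\<bar> \<le> (1 / real n) *\<^sub>R real n *\<^sub>R f"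
          using y(1) by (simp only: abs_scaleR_banach_lattice) (simp add: scaleR_left_mono del: scaleR_scaleR)
        then have "\<bar>(1 / real n) *\<^sub>R y\<bar> \<le> f" using False by simp
        then have "(1 / real n) *\<^sub>R y \<in> ?C"
          by (metis (mono_tags, lifting) abs_ge_minus_self abs_ge_self mem_Collect_eq minus_le_iff order_trans)
        then have "R t ((1 / real n) *\<^sub>R y) \<in> ?J" using t0 t by blast
        then have "real n *\<^sub>R R t ((1 / real n) *\<^sub>R y) \<in> ?J" by (rule subspace_scale[OF sub])
        then show ?thesis using False by (simp add: scaleR)
      qed
      moreover have "dist (R t y) (R t x) < e"
        using K(2)[of "y - x"] y(2) K(1) by (simp add: dist_norm diff norm_minus_commute field_simps)
      ultimately show "\<exists>z\<in>?J. dist z (R t x) < e" by blast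
    qed
    then show ?thesis by (simp only: closure_closed[OF closed_principal_closure])
  qed
  then have "?J = {0} \<or> ?J = UNIV"
    using t0(1) by (intro irreducible closed_principal_closure ideal) blast
  then show ?thesis using fJ f(3) by blast
qed

text \<open>The positive part of \<open>g\<close> is fixed, being half of
  \<open>\<bar>g\<bar> + g\<close>. If non-zero, it generates a dense ideal, and the negative part,
  disjoint from it, must vanish.\<close>

lemma fixed_sign:
  assumes g: "g \<in> fixed"
  shows "0 \<le> g \<or> g \<le> 0"
proof (cases "pprt g = 0")
  case True
  then show ?thesis by (simp add: le_zero_iff_zero_pprt)
next
  case False
  have "\<bar>g\<bar> + g = 2 *\<^sub>R pprt g"
  proof -
    have "g - nprt g = pprt g" using prts[of g] by (metis add_diff_cancel_right')
    moreover have "\<bar>g\<bar> + g = pprt g + (g - nprt g)" by (simp add: abs_prts)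
    ultimately show ?thesis by (simp only: scaleR_2)
  qed
  then have "pprt g = (1 / 2) *\<^sub>R (\<bar>g\<bar> + g)" by simp
  then have "pprt g \<in> fixed"
    using g abs_in_fixed[OF g] subspace_fixed by (simp add: subspace_add subspace_scale)
  then have "principal_closure (pprt g) = UNIV" using False by (intro fixed_quasi_interior) auto
  moreover have "inf (- nprt g) (pprt g) = 0"
  proof -
    have "- nprt g = - g + pprt g"
      using prts[of g] by (metis add.commute add_diff_cancel_right' minus_diff_eq uminus_add_conv_diff)
    then have "inf (- nprt g) (pprt g) = inf (- g + pprt g) (0 + pprt g)" by simp
    also have "\<dots> = nprt (- g) + pprt g" by (simp only: add_inf_distrib_right nprt_def)
    finally show ?thesis by (simp add: nprt_neg)
  qed
  moreover have "0 \<le> pprt g" "0 \<le> - nprt g" by simp_all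
  ultimately have "- nprt g = 0"
    using disjoint_principal_closure[of "pprt g" "- nprt g"] UNIV_I by metis
  then show ?thesis by (simp add: zero_le_iff_zero_nprt)
qed

lemma fixed_one_dimensional:
  assumes f: "f \<in> fixed" "0 \<le> f" "f \<noteq> 0" and g: "g \<in> fixed"
  shows "g = (\<psi> g / \<psi> f) *\<^sub>R f"
proof -
  have f0: "\<psi> f \<noteq> 0" using psi_strict f by blast
  \<comment> \<open>The coefficient is chosen to give \<open>\<psi> h = 0\<close>; as
    \<open>h\<close> has a sign, strict positivity forces \<open>h = 0\<close>.\<close>
  define h where "h = g - (\<psi> g / \<psi> f) *\<^sub>R f"
  have "h \<in> fixed"
    using f g subspace_fixed by (simp add: h_def subspace_diff subspace_scale)
  then have "0 \<le> h \<or> 0 \<le> - h" using fixed_sign by auto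
  moreover have "\<psi> h = 0" using f0 by (simp add: h_def psi.diff psi.scaleR)
  ultimately have "h = 0" using psi_strict[of h] psi_strict[of "- h"] by (auto simp: psi.neg)
  then show ?thesis by (simp add: h_def)
qed

end

section \<open>Complexification\<close>

abbreviation real_embed :: "'a::real_vector \<Rightarrow> 'a complexification" where
  "real_embed x \<equiv> Complexification x 0"

lemma bounded_linear_re_part: "bounded_linear (re_part :: 'a::banach_lattice complexification \<Rightarrow> 'a)"
  by (rule bounded_linear_intro[where K = 1]) (auto simp: norm_re_part_le)

lemma bounded_linear_im_part: "bounded_linear (im_part :: 'a::banach_lattice complexification \<Rightarrow> 'a)"
  by (rule bounded_linear_intro[where K = 1]) (auto simp: norm_im_part_le)

lemma bounded_linear_real_embed:
  "bounded_linear (real_embed :: 'a::banach_lattice \<Rightarrow> 'a complexification)"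
proof (rule bounded_linear_intro[where K = 1])
  show "norm (real_embed x) \<le> norm x * 1" for x :: 'a
    using norm_complexification_le[of "real_embed x"] by simp
qed (simp_all add: complexification_eq_iff)

lemma complexification_decompose: "z = real_embed (re_part z) + \<i> *\<^sub>C real_embed (im_part z)"
  by (simp add: complexification_eq_iff)

definition complexify_set :: "'a::banach_lattice set \<Rightarrow> 'a complexification set" where
  "complexify_set J = {z. re_part z \<in> J \<and> im_part z \<in> J}"

lemma closed_complexify_set:
  fixes J :: "'a::banach_lattice set"
  assumes "closed J"
  shows "closed (complexify_set J)"
proof -
  have "complexify_set J = re_part -` J \<inter> im_part -` J" by (auto simp: complexify_set_def)
  then show ?thesis
    using assms bounded_linear_re_part bounded_linear_im_part
    by (auto intro!: closed_Int closed_vimage linear_continuous_on)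
qed

text \<open>Solidity follows by squeezing: real and imaginary parts of \<open>f\<close> lie below
  its modulus, and the modulus of \<open>g\<close> lies below the sum of the absolute values of its
  parts.\<close>

lemma lattice_ideal_complexify_set:
  fixes J :: "'a::banach_lattice set"
  assumes "real_lattice_ideal J"
  shows "lattice_ideal (complexify_set J)"
proof -
  have sub: "subspace J" and solid: "\<And>x y. y \<in> J \<Longrightarrow> \<bar>x\<bar> \<le> \<bar>y\<bar> \<Longrightarrow> x \<in> J"
    using assms by (auto simp: real_lattice_ideal_def)
  have "csubspace (complexify_set J)"
    unfolding complex_vector.subspace_def complexify_set_def
    by (auto intro!: subspace_add[OF sub] subspace_diff[OF sub] subspace_scale[OF sub] subspace_0[OF sub])
  moreover have "f \<in> complexify_set J" if g: "g \<in> complexify_set J" and le: "\<bar>f\<bar> \<le> \<bar>g\<bar>" for f g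
  proof -
    have "\<bar>re_part g\<bar> \<in> J" "\<bar>im_part g\<bar> \<in> J"
      using g solid[of "re_part g" "\<bar>re_part g\<bar>"] solid[of "im_part g" "\<bar>im_part g\<bar>"]
      by (simp_all add: complexify_set_def)
    then have "\<bar>re_part g\<bar> + \<bar>im_part g\<bar> \<in> J" by (rule subspace_add[OF sub])
    moreover have "modulus f \<le> modulus g"
      using le by (simp add: abs_complexification_def less_eq_complexification_def)
    then have "modulus f \<le> \<bar>re_part g\<bar> + \<bar>im_part g\<bar>" using modulus_le_abs_parts[of g] by simp
    then have "\<bar>re_part f\<bar> \<le> \<bar>\<bar>re_part g\<bar> + \<bar>im_part g\<bar>\<bar>" "\<bar>im_part f\<bar> \<le> \<bar>\<bar>re_part g\<bar> + \<bar>im_part g\<bar>\<bar>"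
      using abs_re_part_le_modulus[of f] abs_im_part_le_modulus[of f]
      by (meson abs_ge_self order_trans)+
    ultimately show ?thesis by (auto simp: complexify_set_def intro: solid)
  qed
  ultimately show ?thesis unfolding lattice_ideal_def by blast
qed

lemma quasi_interior_point_real_embed:
  fixes u :: "'a::banach_lattice"
  assumes u: "0 \<le> u" and dense: "principal_closure u = UNIV"
  shows "quasi_interior_point (real_embed u)"
proof -
  have "z \<in> closure (principal_ideal (real_embed u))" for z
    unfolding closure_approachable
  proof (intro allI impI)
    fix e :: real assume e: "e > 0"
    obtain x n where x: "\<bar>x\<bar> \<le> real n *\<^sub>R u" "norm (re_part z - x) < e / 2"
      using principal_closure_approx[OF u, of "re_part z" "e / 2"] dense e by auto
    obtain y m where y: "\<bar>y\<bar> \<le> real m *\<^sub>R u" "norm (im_part z - y) < e / 2"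
      using principal_closure_approx[OF u, of "im_part z" "e / 2"] dense e by auto
    define w where "w = Complexification x y"
    have "modulus w \<le> \<bar>x\<bar> + \<bar>y\<bar>" using modulus_le_abs_parts[of w] by (simp add: w_def)
    also have "\<dots> \<le> real n *\<^sub>R u + real m *\<^sub>R u" using x(1) y(1) by (rule add_mono)
    \<comment> \<open>The extra \<open>1\<close> keeps the constant positive, as
      \<open>principal_ideal\<close> demands, even if \<open>n = m = 0\<close>.\<close>
    also have "\<dots> \<le> (real n + real m + 1) *\<^sub>R u" using u by (simp add: algebra_simps)
    finally have "w \<in> principal_ideal (real_embed u)"
      unfolding principal_ideal_def
      by (intro CollectI exI[of _ "real n + real m + 1"])
        (simp add: abs_complexification_def less_eq_complexification_def)
    moreover have "dist w z < e"
      using norm_complexification_le[of "z - w"] x(2) y(2)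
      by (simp add: dist_norm norm_minus_commute w_def)
    ultimately show "\<exists>w\<in>principal_ideal (real_embed u). dist w z < e" by blast
  qed
  then show ?thesis
    using u by (auto simp: quasi_interior_point_def less_eq_complexification_def)
qed

section \<open>Passage between the complex Banach lattice and its real part\<close>

theorem theorem4p2:
  fixes T :: "real \<Rightarrow> 'a::banach_lattice complexification \<Rightarrow> 'a complexification"
    and A :: "('a complexification \<times> 'a complexification) set"
    and \<mu> :: real
  assumes "C0_semigroup T" and "A = generator T"
    and "real_semigroup T"
    and "individually_eventually_positive T"
    and "persistently_irreducible T"
    and "eigenvalue A (complex_of_real \<mu>)"
    and "eigenvalue (dual_operator A) (complex_of_real \<mu>)"
    and "\<exists>\<phi> \<in> op_ker (shifted_op (complex_of_real \<mu>) (dual_operator A)).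
           positive_functional \<phi> \<and> \<phi> \<noteq> 0"
  shows "algebraically_simple A (complex_of_real \<mu>)
    \<and> (\<exists>u. quasi_interior_point u \<and>
          op_ker (shifted_op (complex_of_real \<mu>) A) = cspan {u})
    \<and> (\<exists>\<psi> \<in> op_ker (shifted_op (complex_of_real \<mu>) (dual_operator A)).
          strictly_positive_functional \<psi>)"
proof -
  obtain \<phi> where \<phi>: "\<phi> \<in> op_ker (shifted_op (complex_of_real \<mu>) (dual_operator A))"
      "positive_functional \<phi>" "\<phi> \<noteq> 0"
    using assms(8) by blast
  define S where "S = rescale \<mu> T"
  define R where "R t x = re_part (S t (real_embed x))" for t x
  define \<psi> where "\<psi> x = Re (blinfun_apply \<phi> (real_embed x))" for x
  interpret S: c0_semigroup S
    unfolding S_def by unfold_locales (rule C0_semigroup_rescale[OF assms(1)])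
  have S_embed: "S t (real_embed x) = real_embed (R t x)" if "t \<ge> 0" for t x
  proof -
    have "real_embed x \<in> real_subspace" by (simp add: real_subspace_def)
    then have "T t (real_embed x) \<in> real_subspace"
      using assms(3) that unfolding real_semigroup_def by blast
    then show ?thesis
      by (simp add: real_subspace_def R_def S_def rescale_def complexification_eq_iff)
  qed
  have S_eq: "S t z = real_embed (R t (re_part z)) + \<i> *\<^sub>C real_embed (R t (im_part z))"
    if t: "t \<ge> 0" for t z
    using S.clinear[OF t] bounded_linear.linear[OF S.linear[OF t]]
    by (subst complexification_decompose[of z])
      (simp only: linear_add bounded_clinear_def S_embed[OF t])
  have S_parts: "re_part (S t z) = R t (re_part z)" "im_part (S t z) = R t (im_part z)"
    if "t \<ge> 0" for t z
    by (simp_all add: S_eq[OF that])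
  have phi_clinear: "bounded_clinear (blinfun_apply \<phi>)"
    and phi_nonneg: "\<And>f. f \<ge> 0 \<Longrightarrow> blinfun_apply \<phi> f \<in> \<real>\<^sub>\<ge>\<^sub>0"
    using \<phi>(2) by (auto simp: positive_functional_def dual_space_def)
  have phi_embed_nonneg: "blinfun_apply \<phi> (real_embed x) \<in> \<real>\<^sub>\<ge>\<^sub>0" if "0 \<le> x" for x
    using that by (intro phi_nonneg) (simp add: less_eq_complexification_def)
  \<comment> \<open>A real vector is a difference of two positive ones, so the functional is real on
    it.\<close>
  have phi_embed: "blinfun_apply \<phi> (real_embed x) = of_real (\<psi> x)" for x
  proof -
    have "real_embed x = real_embed (pprt x) - real_embed (- nprt x)"
      using prts[of x] by (simp add: complexification_eq_iff)
    moreover have "blinfun_apply \<phi> (real_embed (pprt x)) \<in> \<real>" "blinfun_apply \<phi> (real_embed (- nprt x)) \<in> \<real>"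
      using phi_embed_nonneg[of "pprt x"] phi_embed_nonneg[of "- nprt x"]
      by (auto simp: nonneg_Reals_def)
    ultimately have "blinfun_apply \<phi> (real_embed x) \<in> \<real>"
      by (metis Reals_diff blinfun.diff_right)
    then show ?thesis by (simp add: \<psi>_def)
  qed
  have phi_eq: "blinfun_apply \<phi> z = of_real (\<psi> (re_part z)) + \<i> * of_real (\<psi> (im_part z))" for z
    using phi_clinear
    by (subst complexification_decompose[of z])
      (simp only: blinfun.add_right bounded_clinear_def phi_embed scaleC_complex_def)
  interpret eventually_positive_irreducible R \<psi>
  proof (rule eventually_positive_irreducible.intro)
    fix t :: real assume t: "t \<ge> 0"
    have "bounded_linear (\<lambda>x. re_part (S t (real_embed x)))"
      by (intro bounded_linear_compose[OF bounded_linear_re_part]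
          bounded_linear_compose[OF S.linear[OF t]] bounded_linear_real_embed)
    then show "bounded_linear (R t)" by (simp add: R_def[abs_def])
    fix x
    show "\<psi> (R t x) = \<psi> x"
      using dual_eigenvector_invariant[OF assms(1) \<phi>(1)[unfolded assms(2)] t, of "real_embed x"] S_embed[OF t, of x]
      by (simp add: \<psi>_def S_def)
  next
    fix s t :: real and x assume s: "s \<ge> 0" and t: "t \<ge> 0"
    have "real_embed (R (s + t) x) = real_embed (R s (R t x))"
      using S.add[OF s t, of "real_embed x"] s t by (simp add: S_embed)
    then show "R (s + t) x = R s (R t x)" by simp
  next
    fix x :: 'a assume "0 \<le> x"
    then have "0 \<le> real_embed x" by (simp add: less_eq_complexification_def)
    then obtain t0 where "\<forall>t\<ge>t0. T t (real_embed x) \<ge> 0"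
      using assms(4) unfolding individually_eventually_positive_def by blast
    then show "\<forall>\<^sub>F t in at_top. 0 \<le> R t x"
      unfolding eventually_at_top_linorder
      by (intro exI[of _ t0])
        (auto simp: R_def S_def rescale_def less_eq_complexification_def scaleR_nonneg_nonneg)
  next
    fix J :: "'a set"
    assume J: "closed J" "real_lattice_ideal J" "\<exists>t0\<ge>0. \<forall>t\<ge>t0. R t ` J \<subseteq> J"
    then obtain t0 where t0: "t0 \<ge> 0" "\<forall>t\<ge>t0. R t ` J \<subseteq> J" by blast
    \<comment> \<open>Irreducibility of \<open>T\<close> concerns complex ideals, so
      \<open>J\<close> is tested through its complexification. The passage from \<open>S\<close>
      back to \<open>T\<close> only multiplies by a positive scalar.\<close>
    let ?I = "complexify_set J"
    have I: "closed ?I" "lattice_ideal ?I"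
      using J closed_complexify_set lattice_ideal_complexify_set by blast+
    have sub: "subspace J" using J(2) by (simp add: real_lattice_ideal_def)
    have "T t z \<in> ?I" if "t \<ge> t0" "z \<in> ?I" for t z
    proof -
      have "T t z = exp (\<mu> * t) *\<^sub>R S t z" by (simp add: S_def rescale_def flip: exp_add)
      moreover have "R t (re_part z) \<in> J" "R t (im_part z) \<in> J"
        using that t0 by (auto simp: complexify_set_def)
      ultimately show ?thesis
        using that(1) t0(1) sub by (simp add: complexify_set_def S_parts subspace_scale)
    qed
    then have "?I = {0} \<or> ?I = UNIV"
      using assms(5) I t0(1) unfolding persistently_irreducible_def by blast
    moreover have "x \<in> J \<longleftrightarrow> real_embed x \<in> ?I" for x
      using subspace_0[OF sub] by (simp add: complexify_set_def)
    ultimately show "J = {0} \<or> J = UNIV"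
      by (auto simp: complexification_eq_iff)
  next
    show "bounded_linear \<psi>"
      unfolding \<psi>_def
      by (intro bounded_linear_compose[OF bounded_linear_Re]
          bounded_linear_compose[OF blinfun.bounded_linear_right] bounded_linear_real_embed)
    show "0 \<le> \<psi> x" if "0 \<le> x" for x
      using phi_embed_nonneg[OF that] by (simp add: \<psi>_def complex_nonneg_Reals_iff)
    show "\<exists>x. \<psi> x \<noteq> 0"
    proof (rule ccontr)
      assume "\<nexists>x. \<psi> x \<noteq> 0"
      then have "\<phi> = 0" by (intro blinfun_eqI) (simp add: phi_eq)
      with \<phi>(3) show False by simp
    qed
  qed
  let ?B = "shifted_op (complex_of_real \<mu>) A"
  have ker_iff: "z \<in> op_ker ?B \<longleftrightarrow> re_part z \<in> fixed \<and> im_part z \<in> fixed" for z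
    unfolding assms(2) eigenspace_generator[OF assms(1)] S_def[symmetric] fixed_def
    by (auto simp: complexification_eq_iff S_parts)
  \<comment> \<open>An eigenvector has a non-zero real or imaginary part; the absolute value of that
    part is a positive fixed vector.\<close>
  obtain f where f: "f \<in> fixed" "0 \<le> f" "f \<noteq> 0"
  proof -
    obtain z where "z \<noteq> 0" "z \<in> op_ker ?B" using assms(6) by (auto simp: eigenvalue_def)
    then obtain x where "x \<in> fixed" "x \<noteq> 0"
      using ker_iff[of z] by (auto simp: complexification_eq_iff)
    then show thesis using that[of "\<bar>x\<bar>"] abs_in_fixed by simp
  qed
  have psi_f: "\<psi> f \<noteq> 0" using psi_strict f by blast
  let ?u = "real_embed f"
  have ker: "op_ker ?B = cspan {?u}"
    unfolding complex_vector.span_singleton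
  proof (intro set_eqI iffI)
    fix z assume "z \<in> op_ker ?B"
    then have z: "re_part z \<in> fixed" "im_part z \<in> fixed" by (auto simp: ker_iff)
    have "z = Complex (\<psi> (re_part z) / \<psi> f) (\<psi> (im_part z) / \<psi> f) *\<^sub>C ?u"
      using fixed_one_dimensional[OF f z(1)] fixed_one_dimensional[OF f z(2)]
      by (simp add: complexification_eq_iff)
    then show "z \<in> range (\<lambda>k. k *\<^sub>C ?u)" by blast
  next
    fix z assume "z \<in> range (\<lambda>k. k *\<^sub>C ?u)"
    then show "z \<in> op_ker ?B"
      using f(1) subspace_fixed by (auto simp: ker_iff subspace_scale subspace_0)
  qed
  \<comment> \<open>The functional vanishes on the range of \<open>\<mu> - A\<close> but not at
    \<open>?u\<close>, so no non-zero multiple of \<open>?u\<close> lies in that range.\<close>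
  have no_jordan: "g = 0" if hg: "(h, g) \<in> ?B" "g \<in> op_ker ?B" for h g
  proof -
    obtain c where c: "g = c *\<^sub>C ?u"
      using hg(2) unfolding ker complex_vector.span_singleton by blast
    have "blinfun_apply \<phi> g = 0" by (rule dual_eigenvector_annihilates_range[OF \<phi>(1) hg(1)])
    then have "c * of_real (\<psi> f) = 0"
      using phi_clinear by (simp add: c bounded_clinear_def phi_embed scaleC_complex_def)
    then show ?thesis using psi_f by (simp add: c complexification_eq_iff)
  qed
  \<comment> \<open>Splitting off the first application of \<open>?B\<close> leaves an eigenvector
    in its range, which is zero. For \<open>n = 0\<close> the power is the identity relation, with
    kernel \<open>{0}\<close>.\<close>
  have "op_ker (?B ^^ n) \<subseteq> op_ker ?B" for n
  proof (induction n)
    case 0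
    have "0 \<in> op_ker ?B" unfolding ker by (rule complex_vector.span_zero)
    then show ?case by (auto simp: op_ker_def)
  next
    case (Suc n)
    show ?case
    proof
      fix h assume "h \<in> op_ker (?B ^^ Suc n)"
      then have "(h, 0) \<in> ?B ^^ Suc n" by (simp add: op_ker_def)
      then obtain g where g: "(h, g) \<in> ?B" "(g, 0) \<in> ?B ^^ n" by (rule relpow_Suc_E2)
      then have "g \<in> op_ker ?B" using Suc.IH by (auto simp: op_ker_def)
      then have "g = 0" by (rule no_jordan[OF g(1)])
      then show "h \<in> op_ker ?B" using g(1) by (simp add: op_ker_def)
    qed
  qed
  moreover have "op_ker ?B = op_ker (?B ^^ 1)" by simp
  ultimately have "(\<Union>n. op_ker (?B ^^ n)) = cspan {?u}" using ker by blast
  moreover have "cdim {?u} = 1"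
    using f(3) complex_vector.dim_eq_card_independent[of "{?u}"]
    by (simp add: complex_vector.dependent_single complexification_eq_iff)
  ultimately have "algebraically_simple A (complex_of_real \<mu>)"
    by (simp add: algebraically_simple_def)
  moreover have "quasi_interior_point ?u"
    by (rule quasi_interior_point_real_embed[OF f(2) fixed_quasi_interior[OF f]])
  moreover have "strictly_positive_functional \<phi>"
    unfolding strictly_positive_functional_def
  proof (intro conjI allI impI \<phi>(2))
    fix z assume z: "0 \<le> z" "blinfun_apply \<phi> z = 0"
    then have "im_part z = 0" "0 \<le> re_part z" by (auto simp: less_eq_complexification_def)
    moreover from this have "\<psi> (re_part z) = 0" using z(2) by (simp add: phi_eq psi.zero)
    ultimately show "z = 0" using psi_strict by (simp add: complexification_eq_iff)
  qed
  ultimately show ?thesis using ker \<phi>(1) by blast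
qed

end
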